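(* Let $d\ge1$ be an integer, $M_{f,d}>0$, $\alpha\in(0,e^{-1})$, $\beta\in(0,1-\alpha)$, and let $\lambda_1,\dots,\lambda_d>0$ with $\prod_{i=1}^d\lambda_i\le1$. Let $n_1,n_2\ge2$ with $n_1\asymp n_2$ (the ratio $n_1/n_2$ lies between two fixed positive constants). There is a sufficiently large constant $C(M_{f,d},d)>0$ (possibly depending also on the implicit constants in $n_1\asymp n_2$, but not on $n_1,n_2,\alpha,\beta,\lambda_1,\dots,\lambda_d$) such that, whenever $$\epsilon_{n_1,n_2}^2\ \ge\ \|(f_Y-f_Z)-(f_Y-f_Z)*K_{\lambda,d}\|_{L_2}^2+\frac{C(M_{f,d},d)}{\beta\sqrt{\lambda_1\cdots\lambda_d}}\,\log\Big(\frac1\alpha\Big)\cdot\Big(\frac1{n_1}+\frac1{n_2}\Big)$$ (the separation $\epsilon_{n_1,n_2}$ is allowed to depend on the pair $(P_Y,P_Z)$ through the first term), for testing $\mathcal{P}_0=\{(P_Y,P_Z)\in\mathcal{P}^d_\infty:f_Y=f_Z\}$ against $\mathcal{P}_1=\{(P_Y,P_Z)\in\mathcal{P}^d_\infty:\|f_Y-f_Z\|_{L_2}\ge\epsilon_{n_1,n_2}\}$, the permutation test based on the two-sample $U$-statistic $U_{n_1,n_2}$ with the Gaussian kernel satisfies $$\sup_{P\in\mathcal{P}_0}\mathbb{P}_P(U_{n_1,n_2}>c_{1-\alpha})\le\alpha\quad\text{and}\quad\sup_{P\in\mathcal{P}_1}\mathbb{P}_P(U_{n_1,n_2}\le c_{1-\alpha})\le\beta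 .$$
   Context: $\mathcal{P}^d_\infty$ is the set of pairs $(P_Y,P_Z)$ of distributions on $\mathbb{R}^d$ with Lebesgue densities $f_Y,f_Z$ satisfying $\max\{\|f_Y\|_\infty,\|f_Z\|_\infty\}\le M_{f,d}$. $\|f\|_{L_2}^2=\int f^2$, and $*$ is convolution with respect to Lebesgue measure. Gaussian kernel: $K_{\lambda,d}(x):=\frac{1}{(2\pi)^{d/2}\lambda_1\cdots\lambda_d}\exp\{-\frac12\sum_{i=1}^dx_i^2/\lambda_i^2\}$ for $x\in\mathbb{R}^d$, and $g(x,y):=K_{\lambda,d}(x-y)$. Data: $Y_1,\dots,Y_{n_1}$ i.i.d. from $P_Y$ and, independently, $Z_1,\dots,Z_{n_2}$ i.i.d. from $P_Z$. With $h_{\rm ts}(y_1,y_2;z_1,z_2):=g(y_1,y_2)+g(z_1,z_2)-g(y_1,z_2)-g(y_2,z_1)$, $$U_{n_1,n_2}:=\frac{1}{n_1(n_1-1)n_2(n_2-1)}\sum_{i_1\ne i_2}\sum_{j_1\ne j_2}h_{\rm ts}(Y_{i_1},Y_{i_2};Z_{j_1},Z_{j_2}).$$ Permutation critical value: let $n=n_1+n_2$ and $(X_1,\dots,X_n)=(Y_1,\dots,Y_{n_1},Z_1,\dots,Z_{n_2})$. For a permutation $\pi$ of $\{1,\dots,n\}$, $U^\pi_{n_1,n_2}$ is the statistic recomputed with $(X_{\pi_1},\dots,X_{\pi_{n_1}})$ as first sample and $(X_{\pi_{n_1+1}},\dots,X_{\pi_n})$ as second sample. Then $c_{1-\alpha}:=\inf\{t:\frac1{n!}\sum_\pi\mathbb{1}(U^\pi_{n_1,n_2}\le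 t)\ge1-\alpha\}$, and the test rejects when $U_{n_1,n_2}>c_{1-\alpha}$. *)

theory Defs
  imports "HOL-Probability.Probability" "HOL-Combinatorics.Permutations"
begin

definition has_lebesgue_pdf :: "(real^'d) measure \<Rightarrow> bool" where
  "has_lebesgue_pdf P \<longleftrightarrow> (\<exists>f\<in>borel_measurable lborel. P = density lborel f)"

text \<open>A version of the density; it is meaningful only under \<^const>\<open>has_lebesgue_pdf\<close>, and
  then unique up to Lebesgue null sets. All uses below are invariant under the choice of version.\<close>

definition pdf :: "(real^'d) measure \<Rightarrow> real^'d \<Rightarrow> real" where
  "pdf P x = enn2real (RN_deriv lborel P x)"

definition Linf_norm :: "(real^'d \<Rightarrow> real) \<Rightarrow> ereal" where
  "Linf_norm f = esssup lborel (\<lambda>x. ereal \<bar>f x\<bar>)"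

text \<open>The Bochner integral makes this \<open>0\<close> when \<open>f\<close> is not square integrable. It is only applied
  to differences of bounded densities and their convolutions with a Gaussian kernel, which are
  square integrable.\<close>

definition L2_norm :: "(real^'d \<Rightarrow> real) \<Rightarrow> real" where
  "L2_norm f = sqrt (LINT x|lborel. (f x)\<^sup>2)"

definition convolve :: "(real^'d \<Rightarrow> real) \<Rightarrow> (real^'d \<Rightarrow> real) \<Rightarrow> real^'d \<Rightarrow> real" where
  "convolve f h x = (LINT y|lborel. f y * h (x - y))"

definition P_infty :: "real \<Rightarrow> ((real^'d) measure \<times> (real^'d) measure) set" where
  "P_infty M = {(PY, PZ). prob_space PY \<and> prob_space PZ \<and>
     has_lebesgue_pdf PY \<and> has_lebesgue_pdf PZ \<and>
     max (Linf_norm (pdf PY)) (Linf_norm (pdf PZ)) \<le> ereal M}"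

definition P_null :: "real \<Rightarrow> ((real^'d) measure \<times> (real^'d) measure) set" where
  "P_null M = {(PY, PZ) \<in> P_infty M. AE x in lborel. pdf PY x = pdf PZ x}"

text \<open>The separation may depend on the pair of distributions.\<close>

definition P_alt :: "real \<Rightarrow> ((real^'d) measure \<times> (real^'d) measure \<Rightarrow> real) \<Rightarrow>
    ((real^'d) measure \<times> (real^'d) measure) set" where
  "P_alt M eps = {(PY, PZ) \<in> P_infty M. L2_norm (\<lambda>x. pdf PY x - pdf PZ x) \<ge> eps (PY, PZ)}"

definition gauss_kernel :: "real^'d \<Rightarrow> real^'d \<Rightarrow> real" where
  "gauss_kernel bw x = 1 / ((2 * pi) powr (real CARD('d) / 2) * (\<Prod>i\<in>UNIV. bw $ i)) *
     exp (- (1/2) * (\<Sum>i\<in>UNIV. (x $ i)\<^sup>2 / (bw $ i)\<^sup>2))"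

definition h_ts :: "(real^'d \<Rightarrow> real^'d \<Rightarrow> real) \<Rightarrow>
    real^'d \<Rightarrow> real^'d \<Rightarrow> real^'d \<Rightarrow> real^'d \<Rightarrow> real" where
  "h_ts g y1 y2 z1 z2 = g y1 y2 + g z1 z2 - g y1 z2 - g y2 z1"

text \<open>Samples are functions on \<open>nat\<close> of which only the values at \<open>1, \<dots>, n\<close> matter.\<close>

definition U_stat :: "real^'d \<Rightarrow> nat \<Rightarrow> nat \<Rightarrow> (nat \<Rightarrow> real^'d) \<Rightarrow> (nat \<Rightarrow> real^'d) \<Rightarrow> real" where
  "U_stat bw n1 n2 y z =
     1 / (real n1 * (real n1 - 1) * real n2 * (real n2 - 1)) *
     (\<Sum>(i1, i2) \<in> {(i1, i2). i1 \<in> {1..n1} \<and> i2 \<in> {1..n1} \<and> i1 \<noteq> i2}.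
      \<Sum>(j1, j2) \<in> {(j1, j2). j1 \<in> {1..n2} \<and> j2 \<in> {1..n2} \<and> j1 \<noteq> j2}.
        h_ts (\<lambda>u v. gauss_kernel bw (u - v)) (y i1) (y i2) (z j1) (z j2))"

text \<open>The argument \<open>x\<close> is the pooled sample, the first sample followed by the second.\<close>

definition U_perm :: "real^'d \<Rightarrow> nat \<Rightarrow> nat \<Rightarrow> (nat \<Rightarrow> real^'d) \<Rightarrow> (nat \<Rightarrow> nat) \<Rightarrow> real" where
  "U_perm bw n1 n2 x p = U_stat bw n1 n2 (\<lambda>i. x (p i)) (\<lambda>j. x (p (n1 + j)))"

definition perm_crit :: "real^'d \<Rightarrow> nat \<Rightarrow> nat \<Rightarrow> real \<Rightarrow> (nat \<Rightarrow> real^'d) \<Rightarrow> real" where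
  "perm_crit bw n1 n2 \<alpha> x =
     Inf {t. 1 / fact (n1 + n2) *
             (\<Sum>p | p permutes {1..n1 + n2}. of_bool (U_perm bw n1 n2 x p \<le> t)) \<ge> 1 - \<alpha>}"

text \<open>Joint law of the pooled sample: independent coordinates, the first \<open>n1\<close> distributed
  according to the first component of the pair and the other \<open>n2\<close> according to the second.\<close>

definition sample_law :: "nat \<Rightarrow> nat \<Rightarrow> (real^'d) measure \<times> (real^'d) measure \<Rightarrow>
    (nat \<Rightarrow> real^'d) measure" where
  "sample_law n1 n2 P = (\<Pi>\<^sub>M i\<in>{1..n1 + n2}. if i \<le> n1 then fst P else snd P)"

definition reject :: "real^'d \<Rightarrow> nat \<Rightarrow> nat \<Rightarrow> real \<Rightarrow> (nat \<Rightarrow> real^'d) \<Rightarrow> bool" where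
  "reject bw n1 n2 \<alpha> x \<longleftrightarrow>
     U_stat bw n1 n2 x (\<lambda>j. x (n1 + j)) > perm_crit bw n1 n2 \<alpha> x"

end

theory Submission
  imports Defs
begin

text \<open>
  Type I error: under the null hypothesis the pooled sample is exchangeable, so the rejection
  probability equals the expected proportion of permutations whose statistic ranks among the
  largest \<open>\<alpha> n!\<close>.

  Type II error: write \<open>G\<close> for the sum of the squared kernel values over all pairs of distinct
  pooled observations. The permuted statistic, averaged over permutations of the two samples, is a
  second order Rademacher chaos in the swaps of the pairs \<open>(i, n1 + i)\<close>, so its exponential moment
  is bounded at the scale \<open>sqrt G / m\<^sup>2\<close> with \<open>m = min n1 n2\<close>; acceptance therefore forces
  \<open>U \<le> 20 ln (1 / \<alpha>) sqrt G / (m (m - 1))\<close>. On the other side, the mean of \<open>U\<close> is \<open>\<langle>\<delta>, \<psi>\<rangle>\<close> with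
  \<open>\<delta> = f\<^sub>Y - f\<^sub>Z\<close> and \<open>\<psi> = \<delta> * K\<close>, and polarization turns it into half of
  \<open>\<parallel>\<delta>\<parallel>\<^sup>2 + \<parallel>\<psi>\<parallel>\<^sup>2 - \<parallel>\<delta> - \<psi>\<parallel>\<^sup>2\<close>. The Hoeffding decomposition bounds the fluctuations of \<open>U\<close>
  (the part linear in the sample is absorbed by \<open>\<parallel>\<psi>\<parallel>\<^sup>2\<close>), and Markov's inequality bounds \<open>G\<close>.
\<close>

section \<open>Rademacher chaos\<close>

text \<open>Two demands shape the argument. The price of a small level must be logarithmic in 1 /
  \<alpha>, so Chebyshev's inequality over permutations, which costs a power of 1 / \<alpha>, is
  replaced by an exponential moment. And the critical value is random, so its bound must still be
  controllable under the alternative. \<open>G\<close> meets both: it is invariant under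
  permutations of the pooled sample, so one exponent serves them all, and only its mean is needed
  afterwards. That mean produces the factor 1 / sqrt L, with L the product of the bandwidths: the
  squared kernel is at most 1 / L times the kernel, and a kernel of mass one has mean at most
  \<open>M\<close> under a density bounded by \<open>M\<close>. This gives \<open>M / L\<close> per
  pair where the sup norm alone would give \<open>1 / L^2\<close>. The degenerate part of
  \<open>U\<close> is treated by the same trade. The remaining assumptions tie the scales together.
  Comparability of the sample sizes compares n1 + n2 with \<open>m\<close>, the number of pairs;
  \<alpha> < 1/e gives ln (1 / \<alpha>) > 1, so terms without a logarithm are absorbed; L \<le> 1
  does the same for the linear part, whose contribution r M / \<beta> (r = 1/n1 + 1/n2) has no
  factor 1 / sqrt L.\<close>

lemma cosh_le_exp_square: "cosh x \<le> exp (x\<^sup>2 / 2)" for x :: real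
proof -
  have bij: "(\<lambda>n. x ^ (2 * n) /\<^sub>R fact (2 * n)) sums cosh x"
  proof -
    have "strict_mono (\<lambda>n::nat. 2 * n)" by (simp add: strict_mono_def)
    moreover have "(if even n then x ^ n /\<^sub>R fact n else 0) = 0" if "n \<notin> range (\<lambda>n::nat. 2 * n)" for n
      using that by (auto elim!: evenE)
    ultimately have "(\<lambda>n. (if even (2 * n) then x ^ (2 * n) /\<^sub>R fact (2 * n) else 0)) sums cosh x"
      using sums_mono_reindex[of "\<lambda>n. 2 * n" "\<lambda>n. if even n then x ^ n /\<^sub>R fact n else 0" "cosh x"] cosh_converges[of x]
      by blast
    then show ?thesis by simp
  qed
  \<comment> \<open>The two power series are compared term by term, which comes down to this
    inequality.\<close>
  have fact_ge: "(2::real) ^ n * fact n \<le> fact (2 * n)" for n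
  proof (induction n)
    case (Suc n)
    have "(2::real) ^ Suc n * fact (Suc n) = (2 * real (Suc n)) * (2 ^ n * fact n)" by simp
    also have "\<dots> \<le> (2 * real (Suc n)) * fact (2 * n)" by (intro mult_left_mono Suc.IH) simp
    also have "\<dots> \<le> (2 * real (Suc n)) * (real (2 * n + 1) * fact (2 * n))"
      by (intro mult_left_mono) (auto simp: algebra_simps)
    also have "\<dots> = fact (2 * Suc n)" by (simp add: algebra_simps)
    finally show ?case .
  qed simp
  show ?thesis
  proof (rule sums_le[OF _ bij exp_converges])
    fix n
    have "x ^ (2 * n) / fact (2 * n) \<le> x ^ (2 * n) / (2 ^ n * fact n)"
      using fact_ge[of n] by (intro divide_left_mono) (auto simp: power_mult)
    then show "x ^ (2 * n) /\<^sub>R fact (2 * n) \<le> (x\<^sup>2 / 2) ^ n /\<^sub>R fact n"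
      by (simp add: power_divide flip: power_mult) (simp add: divide_simps mult.commute)
  qed
qed

text \<open>Induction on the index set. Averaging over the sign of \<open>k\<close> leaves \<open>cosh (2 L) \<le> exp (2 L\<^sup>2)\<close>
  with \<open>L\<close> linear in the other signs, which is absorbed into the new matrix \<open>a'\<close>. Its trace grows by
  \<open>2 s\<close>, and \<open>F \<le> 1/4\<close> is what makes its Frobenius norm drop by \<open>2 s\<close>.\<close>

lemma rademacher_chaos_exp_moment:
  fixes a :: "'i \<Rightarrow> 'i \<Rightarrow> real"
  assumes "finite I" "\<And>i j. i \<in> I \<Longrightarrow> j \<in> I \<Longrightarrow> a i j = a j i"
    and "(\<Sum>i\<in>I. \<Sum>j\<in>I. (a i j)\<^sup>2) \<le> F\<^sup>2" "0 \<le> F" "F \<le> 1/4"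
  shows "(\<Sum>S\<in>Pow I. exp (\<Sum>i\<in>I. \<Sum>j\<in>I. a i j * ((if i \<in> S then 1 else -1) * (if j \<in> S then 1 else -1))))
    \<le> 2 ^ card I * exp ((\<Sum>i\<in>I. a i i) + F)"
  using assms
proof (induction I arbitrary: a F rule: finite_induct)
  case empty
  then show ?case by simp
next
  case (insert k I)
  define e where "e S i = (if i \<in> S then 1 else -1 :: real)" for S and i :: 'i
  define s where "s = (\<Sum>j\<in>I. (a k j)\<^sup>2)"
  define a' where "a' i j = a i j + 2 * a k i * a k j" for i j
  define Q where "Q S = (\<Sum>i\<in>I. \<Sum>j\<in>I. a i j * (e S i * e S j))" for S
  define L where "L S = (\<Sum>j\<in>I. a k j * e S j)" for S
  have sym: "a i j = a j i" if "i \<in> insert k I" "j \<in> insert k I" for i j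
    using insert.prems(1) that by blast
  have s0: "s \<ge> 0" unfolding s_def by (intro sum_nonneg) auto
  have total: "(\<Sum>i\<in>insert k I. \<Sum>j\<in>insert k I. (a i j)\<^sup>2)
      = (a k k)\<^sup>2 + 2 * s + (\<Sum>i\<in>I. \<Sum>j\<in>I. (a i j)\<^sup>2)"
    using insert.hyps sym by (simp add: s_def sum.distrib)
  have A: "(\<Sum>i\<in>I. \<Sum>j\<in>I. (a i j)\<^sup>2) \<le> F\<^sup>2 - 2 * s"
    using insert.prems(2) zero_le_power2[of "a k k"] unfolding total by linarith
  have A2: "(\<Sum>i\<in>I. \<Sum>j\<in>I. (a i j)\<^sup>2) \<le> F\<^sup>2" using A s0 by linarith
  \<comment> \<open>Towards \<open>2 * s \<le> F\<close>: the induction hypothesis will be used with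
    radius \<open>F - 2 * s\<close>, which has to be nonnegative.\<close>
  have "0 \<le> F\<^sup>2 - 2 * s" using A by (smt (verit) sum_nonneg zero_le_power2)
  moreover have "F\<^sup>2 \<le> F * (1/4)" unfolding power2_eq_square
    using insert.prems(3,4) by (intro mult_left_mono) auto
  ultimately have sF: "2 * s \<le> F" using insert.prems(3,4) by linarith
  have CS: "(\<Sum>i\<in>I. \<Sum>j\<in>I. a i j * (a k i * a k j)) \<le> F * s"
  proof -
    have "(\<Sum>p\<in>I\<times>I. a (fst p) (snd p) * (a k (fst p) * a k (snd p)))\<^sup>2
       \<le> (\<Sum>p\<in>I\<times>I. (a (fst p) (snd p))\<^sup>2) * (\<Sum>p\<in>I\<times>I. (a k (fst p) * a k (snd p))\<^sup>2)"
      by (rule Cauchy_Schwarz_ineq_sum)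
    also have "(\<Sum>p\<in>I\<times>I. (a (fst p) (snd p))\<^sup>2) = (\<Sum>i\<in>I. \<Sum>j\<in>I. (a i j)\<^sup>2)"
      by (simp add: sum.cartesian_product case_prod_beta)
    also have "(\<Sum>p\<in>I\<times>I. (a k (fst p) * a k (snd p))\<^sup>2) = s\<^sup>2"
      by (simp add: s_def power2_eq_square sum_product sum.cartesian_product case_prod_beta mult_ac)
    also have "(\<Sum>i\<in>I. \<Sum>j\<in>I. (a i j)\<^sup>2) * s\<^sup>2 \<le> F\<^sup>2 * s\<^sup>2"
      using A2 by (intro mult_right_mono) auto
    finally have "(\<Sum>p\<in>I\<times>I. a (fst p) (snd p) * (a k (fst p) * a k (snd p)))\<^sup>2 \<le> (F * s)\<^sup>2"
      by (simp add: power_mult_distrib)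
    then have "(\<Sum>p\<in>I\<times>I. a (fst p) (snd p) * (a k (fst p) * a k (snd p))) \<le> F * s"
      by (rule power2_le_imp_le) (use s0 insert.prems(3) in simp)
    then show ?thesis by (simp add: sum.cartesian_product case_prod_beta)
  qed
  have "(\<Sum>i\<in>I. \<Sum>j\<in>I. (a' i j)\<^sup>2)
      = (\<Sum>i\<in>I. \<Sum>j\<in>I. (a i j)\<^sup>2) + 4 * (\<Sum>i\<in>I. \<Sum>j\<in>I. a i j * (a k i * a k j)) + 4 * s\<^sup>2"
    unfolding a'_def s_def power2_eq_square[of "sum _ _"] sum_product
    by (simp add: power2_sum sum.distrib sum_distrib_left power_mult_distrib algebra_simps power2_eq_square)
  also have "\<dots> \<le> (F\<^sup>2 - 2 * s) + 4 * (F * s) + 4 * s\<^sup>2" using A CS by linarith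
  \<comment> \<open>After cancellation this reads \<open>8 * F * s \<le> 2 * s\<close>, which is
    where 1/4 comes from.\<close>
  also have "\<dots> \<le> (F - 2 * s)\<^sup>2"
  proof -
    have "F * s \<le> 1/4 * s" using insert.prems(4) s0 by (intro mult_right_mono) auto
    then show ?thesis by (simp add: power2_diff power_mult_distrib)
  qed
  finally have Fro: "(\<Sum>i\<in>I. \<Sum>j\<in>I. (a' i j)\<^sup>2) \<le> (F - 2 * s)\<^sup>2" .
  \<comment> \<open>The gain \<open>2 * s\<close> in the trace and the loss \<open>2 * s\<close> in
    the radius cancel, so the exponent trace plus radius passes through the induction without
    loss.\<close>
  have IH: "(\<Sum>S\<in>Pow I. exp (\<Sum>i\<in>I. \<Sum>j\<in>I. a' i j * (e S i * e S j)))
      \<le> 2 ^ card I * exp ((\<Sum>i\<in>I. a' i i) + (F - 2 * s))"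
    unfolding e_def
    by (rule insert.IH) (use Fro sF s0 insert.prems sym in \<open>auto simp: a'_def\<close>)
  have Q': "(\<Sum>i\<in>I. \<Sum>j\<in>I. a' i j * (e S i * e S j)) = Q S + 2 * (L S)\<^sup>2" for S
    unfolding a'_def Q_def L_def power2_eq_square sum_product
    by (simp add: sum.distrib sum_distrib_left algebra_simps)
  have tr: "(\<Sum>i\<in>I. a' i i) = (\<Sum>i\<in>I. a i i) + 2 * s"
    by (simp add: a'_def s_def sum.distrib sum_distrib_left power2_eq_square mult_ac)
  have form: "(\<Sum>i\<in>insert k I. \<Sum>j\<in>insert k I. a i j * (e T i * e T j))
      = a k k + 2 * e T k * L T + Q T" for T
  proof -
    have kk: "e T k * e T k = 1" by (simp add: e_def)
    have "(\<Sum>i\<in>I. a i k * (e T i * e T k)) = e T k * L T"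
      unfolding L_def sum_distrib_left
      by (intro sum.cong) (use sym in \<open>auto simp: mult_ac\<close>)
    then show ?thesis
      using insert.hyps kk unfolding Q_def
      by (simp add: sum.distrib L_def sum_distrib_left mult_ac)
  qed
  have ekI: "e (insert k S) i = e S i" if "i \<in> I" for S i
    using that insert.hyps by (auto simp: e_def)
  have LQ: "L (insert k S) = L S" "Q (insert k S) = Q S" for S
    unfolding L_def Q_def by (simp_all add: ekI)
  have cosh2: "exp (2 * u) + exp (- (2 * u)) \<le> 2 * exp (2 * u\<^sup>2)" for u :: real
    using cosh_le_exp_square[of "2 * u"] by (simp add: cosh_def power_mult_distrib)
  have inj: "inj_on (insert k) (Pow I)"
    using insert.hyps by (auto simp: inj_on_def)
  have "(\<Sum>S\<in>Pow (insert k I). exp (\<Sum>i\<in>insert k I. \<Sum>j\<in>insert k I. a i j * (e S i * e S j)))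
      = (\<Sum>S\<in>Pow I. exp (a k k + 2 * e S k * L S + Q S) + exp (a k k + 2 * e (insert k S) k * L S + Q S))"
    unfolding form Pow_insert
    by (subst sum.union_disjoint) (use insert.hyps inj in \<open>auto simp: sum.reindex LQ sum.distrib\<close>)
  also have "\<dots> = (\<Sum>S\<in>Pow I. exp (a k k + Q S) * (exp (2 * L S) + exp (- (2 * L S))))"
  proof (intro sum.cong refl)
    fix S assume "S \<in> Pow I"
    then have "e S k = -1" "e (insert k S) k = 1" using insert.hyps by (auto simp: e_def)
    then show "exp (a k k + 2 * e S k * L S + Q S) + exp (a k k + 2 * e (insert k S) k * L S + Q S)
      = exp (a k k + Q S) * (exp (2 * L S) + exp (- (2 * L S)))"
      by (simp add: exp_add exp_diff exp_minus field_simps)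
  qed
  also have "\<dots> \<le> (\<Sum>S\<in>Pow I. exp (a k k + Q S) * (2 * exp (2 * (L S)\<^sup>2)))"
    by (intro sum_mono mult_left_mono cosh2) auto
  also have "\<dots> = 2 * exp (a k k) * (\<Sum>S\<in>Pow I. exp (\<Sum>i\<in>I. \<Sum>j\<in>I. a' i j * (e S i * e S j)))"
    unfolding Q' sum_distrib_left by (simp add: exp_add mult_ac)
  also have "\<dots> \<le> 2 * exp (a k k) * (2 ^ card I * exp ((\<Sum>i\<in>I. a' i i) + (F - 2 * s)))"
    by (intro mult_left_mono IH) auto
  also have "\<dots> = 2 ^ card (insert k I) * exp ((\<Sum>i\<in>insert k I. a i i) + F)"
    using insert.hyps unfolding tr by (simp add: exp_add exp_diff mult_ac)
  finally show ?case unfolding e_def .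
qed

section \<open>Permutations\<close>

definition off_diag :: "'i set \<Rightarrow> ('i \<times> 'i) set" where
  "off_diag I = {(i, j). i \<in> I \<and> j \<in> I \<and> i \<noteq> j}"

lemma finite_off_diag [simp]: "finite I \<Longrightarrow> finite (off_diag I)"
  by (rule finite_subset[of _ "I \<times> I"]) (auto simp: off_diag_def)

lemma card_off_diag: "finite I \<Longrightarrow> card (off_diag I) = card I * (card I - 1)"
proof -
  assume fin: "finite I"
  have "off_diag I = I \<times> I - (\<lambda>i. (i, i)) ` I" by (auto simp: off_diag_def)
  moreover have "card (I \<times> I - (\<lambda>i. (i, i)) ` I) = card (I \<times> I) - card ((\<lambda>i. (i, i)) ` I)"
    using fin by (intro card_Diff_subset) auto
  ultimately show ?thesis
    using fin by (simp add: card_image inj_on_def diff_mult_distrib2 card_cartesian_product)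
qed

lemma bij_betw_off_diag:
  assumes "bij_betw p I J"
  shows "bij_betw (map_prod p p) (off_diag I) (off_diag J)"
  unfolding bij_betw_def
proof
  show "inj_on (map_prod p p) (off_diag I)"
    using assms by (auto simp: inj_on_def off_diag_def bij_betw_def)
  have J: "J = p ` I" using assms by (simp add: bij_betw_def)
  show "map_prod p p ` off_diag I = off_diag J"
  proof
    show "map_prod p p ` off_diag I \<subseteq> off_diag J"
      using assms by (auto simp: off_diag_def bij_betw_def inj_on_def)
    show "off_diag J \<subseteq> map_prod p p ` off_diag I"
    proof
      fix z assume "z \<in> off_diag J"
      then obtain i j where "i \<in> I" "j \<in> I" "z = (p i, p j)" "p i \<noteq> p j"
        unfolding off_diag_def J by auto
      then show "z \<in> map_prod p p ` off_diag I"
        by (intro image_eqI[of _ _ "(i, j)"]) (auto simp: off_diag_def)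
    qed
  qed
qed

lemma sum_off_diag_permutes:
  assumes "p permutes I"
  shows "(\<Sum>(i, j)\<in>off_diag I. F (p i) (p j)) = (\<Sum>(i, j)\<in>off_diag I. F i j :: real)"
  using sum.reindex_bij_betw[OF bij_betw_off_diag[OF permutes_imp_bij[OF assms]], of "\<lambda>(i, j). F i j"]
  by (simp add: case_prod_beta)

lemma sum_permutes_compose_right:
  assumes "q permutes I"
  shows "(\<Sum>p | p permutes I. F (p \<circ> q)) = (\<Sum>p | p permutes I. F p :: real)"
proof (rule sum.reindex_bij_witness[of _ "\<lambda>p. p \<circ> inv q" "\<lambda>p. p \<circ> q"])
  fix p assume "p \<in> {p. p permutes I}"
  then show "p \<circ> q \<circ> inv q = p" "p \<circ> inv q \<circ> q = p" "p \<circ> q \<in> {p. p permutes I}" "p \<circ> inv q \<in> {p. p permutes I}"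
    using assms permutes_inv[OF assms]
    by (auto simp: comp_assoc permutes_inv_o[OF assms] intro: permutes_compose)
qed auto

text \<open>Two transpositions suffice: the first carries \<open>i\<close> to \<open>a\<close>; the
  second carries the image of \<open>j\<close> to \<open>b\<close> and leaves \<open>a\<close>
  alone, since neither of its points is \<open>a\<close>.\<close>

lemma exists_permutes_pair:
  assumes "i \<noteq> j" "a \<noteq> b" "i \<in> I" "j \<in> I" "a \<in> I" "b \<in> I"
  shows "\<exists>q. q permutes I \<and> q i = a \<and> q j = b"
proof -
  define q1 where "q1 = Transposition.transpose i a"
  define q where "q = Transposition.transpose (q1 j) b \<circ> q1"
  have q1: "q1 permutes I" unfolding q1_def using assms by (intro permutes_swap_id)
  moreover have "q1 j \<in> I" using q1 assms permutes_in_image by metis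
  ultimately have "q permutes I" unfolding q_def
    using assms by (intro permutes_compose permutes_swap_id)
  moreover have "q1 i = a" "q1 j \<noteq> a"
    using assms unfolding q1_def by (auto simp: Transposition.transpose_def)
  then have "q i = a" "q j = b" using assms by (auto simp: q_def Transposition.transpose_def)
  ultimately show ?thesis by blast
qed

text \<open>Permutations act transitively on ordered pairs of distinct points, so the left sum does
  not depend on \<open>(i, j)\<close>. Averaging it over all such pairs avoids counting the
  permutations with prescribed values.\<close>

lemma sum_permutes_pair:
  assumes "finite I" "(i, j) \<in> off_diag I"
  shows "real (card I) * (real (card I) - 1) * (\<Sum>p | p permutes I. F (p i) (p j))
    = fact (card I) * (\<Sum>(a, b)\<in>off_diag I. F a b)"
proof -
  define S where "S a b = (\<Sum>p | p permutes I. F (p a) (p b))" for a b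
  have const: "S a b = S i j" if "(a, b) \<in> off_diag I" for a b
  proof -
    have "i \<noteq> j" "a \<noteq> b" "i \<in> I" "j \<in> I" "a \<in> I" "b \<in> I"
      using that assms by (auto simp: off_diag_def)
    from exists_permutes_pair[OF this]
    obtain q where q: "q permutes I" "q i = a" "q j = b" by blast
    have "S i j = (\<Sum>p | p permutes I. F ((p \<circ> q) i) ((p \<circ> q) j))"
      unfolding S_def using sum_permutes_compose_right[OF q(1), of "\<lambda>p. F (p i) (p j)"] by simp
    then show ?thesis by (simp add: S_def q)
  qed
  have "card I \<ge> 1" using assms unfolding off_diag_def by (simp add: Suc_le_eq card_gt_0_iff) blast
  then have "real (card I) * (real (card I) - 1) * S i j = (\<Sum>(a, b)\<in>off_diag I. S i j)"
    using assms by (simp add: card_off_diag of_nat_diff)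
  also have "\<dots> = (\<Sum>(a, b)\<in>off_diag I. S a b)"
    by (intro sum.cong) (auto simp: const)
  also have "\<dots> = (\<Sum>p | p permutes I. \<Sum>(a, b)\<in>off_diag I. F (p a) (p b))"
    unfolding S_def case_prod_beta by (rule sum.swap)
  also have "\<dots> = (\<Sum>p | p permutes I. \<Sum>(a, b)\<in>off_diag I. F a b)"
    by (intro sum.cong refl sum_off_diag_permutes) auto
  finally show ?thesis using assms by (simp add: S_def card_permutations)
qed

section \<open>The statistic as a function of the Gram matrix\<close>

definition h_gram :: "('i \<Rightarrow> 'i \<Rightarrow> real) \<Rightarrow> 'i \<Rightarrow> 'i \<Rightarrow> 'i \<Rightarrow> 'i \<Rightarrow> real" where
  "h_gram k a b c d = k a b + k c d - k a d - k b c"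

text \<open>Only the kernel values enter, indexed by pooled positions with the second sample at
  \<open>n1 + 1, ..., n1 + n2\<close>. Permuting the data thus becomes composing \<open>k\<close>
  with a permutation of the indices.\<close>

definition U_gram :: "nat \<Rightarrow> nat \<Rightarrow> (nat \<Rightarrow> nat \<Rightarrow> real) \<Rightarrow> real" where
  "U_gram n1 n2 k = (\<Sum>(a, b)\<in>off_diag {1..n1}. \<Sum>(c, d)\<in>off_diag {n1+1..n1+n2}. h_gram k a b c d)
     / (real n1 * (real n1 - 1) * real n2 * (real n2 - 1))"

lemma U_stat_eq_U_gram:
  "U_stat bw n1 n2 x (\<lambda>j. x (n1 + j)) = U_gram n1 n2 (\<lambda>a b. gauss_kernel bw (x a - x b))"
proof -
  have "bij_betw ((+) n1) {1..n2} {n1+1..n1+n2}"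
    by (simp add: bij_betw_def image_add_atLeastAtMost)
  then have *: "(\<Sum>(c, d)\<in>off_diag {n1+1..n1+n2}. F c d) = (\<Sum>(c, d)\<in>off_diag {1..n2}. F (n1 + c) (n1 + d))"
    for F :: "nat \<Rightarrow> nat \<Rightarrow> real"
    using sum.reindex_bij_betw[OF bij_betw_off_diag, of "(+) n1" "{1..n2}" "{n1+1..n1+n2}" "\<lambda>(c, d). F c d"]
    by (simp add: case_prod_beta)
  show ?thesis
    unfolding U_stat_def U_gram_def h_gram_def h_ts_def off_diag_def[symmetric] * by simp
qed

lemma U_perm_eq_U_gram:
  "U_perm bw n1 n2 x p = U_gram n1 n2 (\<lambda>a b. gauss_kernel bw (x (p a) - x (p b)))"
  unfolding U_perm_def using U_stat_eq_U_gram[of bw n1 n2 "\<lambda>a. x (p a)"] .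

text \<open>The pairing \<open>i\<close> with \<open>n1 + i\<close> turns the statistic into an average of the sums below, whose
  terms change sign when the members of a pair are swapped.\<close>

definition U_paired :: "nat \<Rightarrow> nat \<Rightarrow> (nat \<Rightarrow> nat \<Rightarrow> real) \<Rightarrow> real" where
  "U_paired m n1 k = (\<Sum>(i, j)\<in>off_diag {1..m}. h_gram k i j (n1 + i) (n1 + j)) / (real m * (real m - 1))"

text \<open>For one pair \<open>(i, j)\<close>, the permutation \<open>s\<close> spreads
  \<open>(i, j)\<close> evenly over the pairs of the first block and \<open>t\<close> spreads
  \<open>(n1 + i, n1 + j)\<close> evenly over those of the second. Hence every single term of
  \<open>U_paired\<close> already averages to \<open>U_gram\<close>; the bounds on \<open>m\<close>
  ensure that the partners exist.\<close>

lemma U_gram_average: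
  assumes m: "2 \<le> m" "m \<le> n1" "m \<le> n2"
  shows "(\<Sum>s | s permutes {1..n1}. \<Sum>t | t permutes {n1+1..n1+n2}.
      U_paired m n1 (\<lambda>a b. k ((s \<circ> t) a) ((s \<circ> t) b)))
    = fact n1 * fact n2 * U_gram n1 n2 k"
proof -
  let ?I = "{1..n1}" and ?J = "{n1+1..n1+n2}"
  \<comment> \<open>Each of \<open>s\<close> and \<open>t\<close> fixes the block of the other, so
    the composition acts as \<open>s\<close> on the first block and as \<open>t\<close> on the
    second.\<close>
  have blk1: "(s \<circ> t) i = s i" if "s permutes ?I" "t permutes ?J" "i \<in> ?I" for s t i
  proof -
    have "i \<notin> ?J" using that(3) by simp
    then show ?thesis using permutes_not_in[OF that(2)] by simp
  qed
  have blk2: "(s \<circ> t) j = t j" if "s permutes ?I" "t permutes ?J" "j \<in> ?J" for s t j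
  proof -
    have "t j \<in> ?J" using permutes_in_image[OF that(2)] that(3) by simp
    then have "t j \<notin> ?I" by simp
    then show ?thesis using permutes_not_in[OF that(1)] by simp
  qed
  define c where "c = real n1 * (real n1 - 1) * (real n2 * (real n2 - 1))"
  have c: "c > 0" using m by (simp add: c_def)
  have one: "c * (\<Sum>s | s permutes ?I. \<Sum>t | t permutes ?J.
        h_gram (\<lambda>a b. k ((s \<circ> t) a) ((s \<circ> t) b)) i j (n1 + i) (n1 + j))
      = fact n1 * fact n2 * (\<Sum>(a, b)\<in>off_diag ?I. \<Sum>(c, d)\<in>off_diag ?J. h_gram k a b c d)"
    if ij: "(i, j) \<in> off_diag {1..m}" for i j
  proof -
    have i1: "(i, j) \<in> off_diag ?I" and i2: "(n1 + i, n1 + j) \<in> off_diag ?J"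
      using ij m by (auto simp: off_diag_def)
    have cI: "card ?I = n1" "finite ?I" and cJ: "card ?J = n2" "finite ?J" by simp_all
    have pI: "real n1 * (real n1 - 1) * (\<Sum>p | p permutes ?I. F (p i) (p j))
        = fact n1 * (\<Sum>(a, b)\<in>off_diag ?I. F a b)" for F
      using sum_permutes_pair[OF cI(2) i1, of F] unfolding cI(1) .
    have pJ: "real n2 * (real n2 - 1) * (\<Sum>p | p permutes ?J. F (p (n1 + i)) (p (n1 + j)))
        = fact n2 * (\<Sum>(a, b)\<in>off_diag ?J. F a b)" for F
      using sum_permutes_pair[OF cJ(2) i2, of F] unfolding cJ(1) .
    have "c * (\<Sum>s | s permutes ?I. \<Sum>t | t permutes ?J.
        h_gram (\<lambda>a b. k ((s \<circ> t) a) ((s \<circ> t) b)) i j (n1 + i) (n1 + j))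
      = c * (\<Sum>s | s permutes ?I. \<Sum>t | t permutes ?J. h_gram k (s i) (s j) (t (n1 + i)) (t (n1 + j)))"
    proof (intro arg_cong[of _ _ "(*) c"] sum.cong refl)
      fix s t assume st: "s \<in> {s. s permutes ?I}" "t \<in> {t. t permutes ?J}"
      have e: "(s \<circ> t) i = s i" "(s \<circ> t) j = s j" "(s \<circ> t) (n1 + i) = t (n1 + i)" "(s \<circ> t) (n1 + j) = t (n1 + j)"
        using st i1 i2 by (intro blk1 blk2; simp add: off_diag_def)+
      show "h_gram (\<lambda>a b. k ((s \<circ> t) a) ((s \<circ> t) b)) i j (n1 + i) (n1 + j)
        = h_gram k (s i) (s j) (t (n1 + i)) (t (n1 + j))"
        unfolding h_gram_def e ..
    qed
    also have "\<dots> = real n1 * (real n1 - 1) * (\<Sum>s | s permutes ?I.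
        real n2 * (real n2 - 1) * (\<Sum>t | t permutes ?J. h_gram k (s i) (s j) (t (n1 + i)) (t (n1 + j))))"
      unfolding c_def by (simp only: sum_distrib_left mult.assoc)
    also have "\<dots> = real n1 * (real n1 - 1) * (\<Sum>s | s permutes ?I.
        fact n2 * (\<Sum>(c, d)\<in>off_diag ?J. h_gram k (s i) (s j) c d))"
    proof -
      have "real n2 * (real n2 - 1) * (\<Sum>t | t permutes ?J. h_gram k (s i) (s j) (t (n1 + i)) (t (n1 + j)))
        = fact n2 * (\<Sum>(c, d)\<in>off_diag ?J. h_gram k (s i) (s j) c d)" for s
        using pJ[of "h_gram k (s i) (s j)"] .
      then show ?thesis by (simp only:)
    qed
    also have "\<dots> = fact n1 * (\<Sum>(a, b)\<in>off_diag ?I. fact n2 * (\<Sum>(c, d)\<in>off_diag ?J. h_gram k a b c d))"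
      using pI[of "\<lambda>a b. fact n2 * (\<Sum>(c, d)\<in>off_diag ?J. h_gram k a b c d)"] .
    finally show ?thesis by (simp only: case_prod_beta sum_distrib_left mult.assoc)
  qed
  have m0: "real m * (real m - 1) > 0" using m by simp
  have cm: "real (card (off_diag {1..m})) = real m * (real m - 1)"
    using m by (simp add: card_off_diag of_nat_diff)
  have "(real m * (real m - 1)) * (c * (\<Sum>s | s permutes ?I. \<Sum>t | t permutes ?J.
      U_paired m n1 (\<lambda>a b. k ((s \<circ> t) a) ((s \<circ> t) b))))
    = c * (\<Sum>s | s permutes ?I. \<Sum>t | t permutes ?J. \<Sum>(i, j)\<in>off_diag {1..m}.
        h_gram (\<lambda>a b. k ((s \<circ> t) a) ((s \<circ> t) b)) i j (n1 + i) (n1 + j))"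
    unfolding U_paired_def sum_divide_distrib[symmetric] using m m0 by simp
  also have "\<dots> = c * (\<Sum>(i, j)\<in>off_diag {1..m}. \<Sum>s | s permutes ?I. \<Sum>t | t permutes ?J.
        h_gram (\<lambda>a b. k ((s \<circ> t) a) ((s \<circ> t) b)) i j (n1 + i) (n1 + j))"
    unfolding case_prod_beta by (subst sum.swap, subst (2) sum.swap) (rule refl)
  also have "\<dots> = (\<Sum>(i, j)\<in>off_diag {1..m}.
      fact n1 * fact n2 * (\<Sum>(a, b)\<in>off_diag ?I. \<Sum>(c, d)\<in>off_diag ?J. h_gram k a b c d))"
    unfolding sum_distrib_left using one by (intro sum.cong) (auto simp: sum_distrib_left)
  also have "\<dots> = (real m * (real m - 1)) * (fact n1 * fact n2 * (c * U_gram n1 n2 k))"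
  proof -
    have c': "real n1 * (real n1 - 1) * real n2 * (real n2 - 1) = c"
      by (simp add: c_def mult.assoc)
    have "c * U_gram n1 n2 k = (\<Sum>(a, b)\<in>off_diag ?I. \<Sum>(c, d)\<in>off_diag ?J. h_gram k a b c d)"
      unfolding U_gram_def c' using c by simp
    then show ?thesis by (simp only: case_prod_unfold sum_constant cm)
  qed
  finally have "(real m * (real m - 1) * c) * (\<Sum>s | s permutes ?I. \<Sum>t | t permutes ?J.
      U_paired m n1 (\<lambda>a b. k ((s \<circ> t) a) ((s \<circ> t) b)))
    = (real m * (real m - 1) * c) * (fact n1 * fact n2 * U_gram n1 n2 k)"
    by (simp only: mult_ac)
  then show ?thesis using c m0 by (subst (asm) mult_cancel_left) auto
qed

section \<open>Swapping paired observations and the exponential moment over permutations\<close>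

definition swap_pairs :: "nat \<Rightarrow> nat set \<Rightarrow> nat \<Rightarrow> nat" where
  "swap_pairs n1 S a = (if a \<in> S then n1 + a else if n1 < a \<and> a - n1 \<in> S then a - n1 else a)"

lemma swap_pairs_involution:
  assumes "S \<subseteq> {1..n1}"
  shows "swap_pairs n1 S (swap_pairs n1 S a) = a"
  using assms unfolding swap_pairs_def by (auto simp: subset_iff)

lemma swap_pairs_permutes:
  assumes "S \<subseteq> {1..m}" "m \<le> n1" "m \<le> n2"
  shows "swap_pairs n1 S permutes {1..n1 + n2}"
proof -
  have inv: "swap_pairs n1 S (swap_pairs n1 S a) = a" for a
    using assms by (intro swap_pairs_involution) auto
  have "bij (swap_pairs n1 S)"
    by (rule o_bij[of "swap_pairs n1 S"]) (auto simp: inv)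
  moreover have "swap_pairs n1 S a = a" if "a \<notin> {1..n1 + n2}" for a
    using assms that unfolding swap_pairs_def by (auto simp: subset_iff)
  ultimately show ?thesis by (simp add: permutes_def bij_iff)
qed

text \<open>For symmetric \<open>k\<close>, \<open>h_gram\<close> is the bilinear form of
  \<open>k\<close> evaluated at the formal differences of \<open>i\<close> and \<open>n1 + i\<close>
  and of \<open>j\<close> and \<open>n1 + j\<close>. A swap negates its difference, so the swaps act
  as signs.\<close>

lemma h_gram_swap_pairs:
  assumes "S \<subseteq> {1..m}" "m \<le> n1" "i \<in> {1..m}" "j \<in> {1..m}" "\<And>a b. k a b = k b a"
  shows "h_gram (\<lambda>a b. k (swap_pairs n1 S a) (swap_pairs n1 S b)) i j (n1 + i) (n1 + j)
    = (if i \<in> S then 1 else -1) * (if j \<in> S then 1 else -1) * h_gram k i j (n1 + i) (n1 + j)"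
proof -
  have *: "swap_pairs n1 S i = (if i \<in> S then n1 + i else i)"
    "swap_pairs n1 S (n1 + i) = (if i \<in> S then i else n1 + i)" if "i \<in> {1..m}" for i
    using assms(1,2) that unfolding swap_pairs_def by (auto simp: subset_iff)
  show ?thesis
    unfolding h_gram_def *[OF assms(3)] *[OF assms(4)]
    using assms(5)[of j "n1 + i"] assms(5)[of j i] assms(5)[of "n1 + j" "n1 + i"] assms(5)[of "n1 + j" i]
    by simp
qed

lemma sum_power2_4_le:
  "(a + b - c - d)\<^sup>2 \<le> 4 * (a\<^sup>2 + b\<^sup>2 + c\<^sup>2 + d\<^sup>2)" for a b c d :: real
proof -
  \<comment> \<open>This sum of squares is exactly the right side minus the left side.\<close>
  have "0 \<le> (a - b)\<^sup>2 + (a + c)\<^sup>2 + (a + d)\<^sup>2 + (b + c)\<^sup>2 + (b + d)\<^sup>2 + (c - d)\<^sup>2" by simp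
  then show ?thesis by (simp add: power2_eq_square algebra_simps)
qed

text \<open>One factor 4 comes from squaring a sum of four terms. The other comes from the four
  families of kernel entries, each of which embeds injectively into the distinct pooled
  pairs.\<close>

lemma sum_h_gram_power2_le:
  fixes m n1 n2 :: nat
  assumes "m \<le> n1" "m \<le> n2"
  shows "(\<Sum>(i, j)\<in>off_diag {1..m}. (h_gram k i j (n1 + i) (n1 + j))\<^sup>2)
    \<le> 16 * (\<Sum>(a, b)\<in>off_diag {1..n1 + n2}. (k a b)\<^sup>2)"
proof -
  let ?O = "off_diag {1..m}" and ?G = "\<Sum>z\<in>off_diag {1..n1 + n2}. (k (fst z) (snd z))\<^sup>2"
  have part: "(\<Sum>z\<in>?O. (k (fst (f z)) (snd (f z)))\<^sup>2) \<le> ?G"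
    if "inj_on f ?O" "f ` ?O \<subseteq> off_diag {1..n1 + n2}" for f
  proof -
    have "(\<Sum>z\<in>?O. (k (fst (f z)) (snd (f z)))\<^sup>2) = (\<Sum>z\<in>f ` ?O. (k (fst z) (snd z))\<^sup>2)"
      using that by (simp add: sum.reindex)
    also have "\<dots> \<le> ?G" using that by (intro sum_mono2) auto
    finally show ?thesis .
  qed
  have "(\<Sum>z\<in>?O. (h_gram k (fst z) (snd z) (n1 + fst z) (n1 + snd z))\<^sup>2)
    \<le> (\<Sum>z\<in>?O. 4 * ((k (fst z) (snd z))\<^sup>2 + (k (n1 + fst z) (n1 + snd z))\<^sup>2
         + (k (fst z) (n1 + snd z))\<^sup>2 + (k (snd z) (n1 + fst z))\<^sup>2))"
    unfolding h_gram_def by (intro sum_mono sum_power2_4_le)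
  also have "\<dots> = 4 * ((\<Sum>z\<in>?O. (k (fst z) (snd z))\<^sup>2) + (\<Sum>z\<in>?O. (k (n1 + fst z) (n1 + snd z))\<^sup>2)
      + (\<Sum>z\<in>?O. (k (fst z) (n1 + snd z))\<^sup>2) + (\<Sum>z\<in>?O. (k (snd z) (n1 + fst z))\<^sup>2))"
    by (simp only: sum_distrib_left[symmetric] sum.distrib)
  also have "\<dots> \<le> 4 * (?G + ?G + ?G + ?G)"
    using assms
    by (intro mult_left_mono add_mono part[of "\<lambda>z. z"]
          part[of "\<lambda>z. (n1 + fst z, n1 + snd z)", unfolded fst_conv snd_conv]
          part[of "\<lambda>z. (fst z, n1 + snd z)", unfolded fst_conv snd_conv]
          part[of "\<lambda>z. (snd z, n1 + fst z)", unfolded fst_conv snd_conv])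
       (auto simp: off_diag_def inj_on_def)
  finally show ?thesis by (simp add: case_prod_unfold)
qed

text \<open>Jensen's inequality over permutations within the blocks replaces \<open>U_gram\<close>
  by \<open>U_paired\<close>; inserting random swaps turns that into a chaos. The condition on
  \<open>l\<close> says that its Frobenius norm, at most
  \<open>4 * l * sqrt G / (m * (m - 1))\<close> with \<open>G\<close> the sum under the root, stays
  within the admissible 1/4.\<close>

lemma permutation_exp_moment:
  assumes m: "2 \<le> m" "m \<le> n1" "m \<le> n2" and sym: "\<And>a b. k a b = k b a"
    and l: "l \<ge> 0" "16 * l * sqrt (\<Sum>(a, b)\<in>off_diag {1..n1 + n2}. (k a b)\<^sup>2) \<le> real m * (real m - 1)"
  shows "(\<Sum>p | p permutes {1..n1 + n2}. exp (l * U_gram n1 n2 (\<lambda>a b. k (p a) (p b))))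
    \<le> fact (n1 + n2) * exp (1/4)"
proof -
  let ?N = "{1..n1 + n2}" and ?I = "{1..n1}" and ?J = "{n1+1..n1+n2}" and ?m = "{1..m}"
  define P where "P = {p. p permutes ?N}"
  define V where "V p = exp (l * U_paired m n1 (\<lambda>a b. k (p a) (p b)))" for p :: "nat \<Rightarrow> nat"
  define c where "c = (fact n1 * fact n2 :: real)"
  have c0: "c > 0" by (simp add: c_def)
  have m0: "real m * (real m - 1) > 0" using m by simp
  have finP: "finite P" unfolding P_def by (simp add: finite_permutations)
  have cards: "(\<Sum>s | s permutes ?I. \<Sum>t | t permutes ?J. 1) = c"
    by (simp add: card_permutations c_def)
  have reindex: "(\<Sum>p\<in>P. V (p \<circ> q)) = (\<Sum>p\<in>P. V p)" if "q permutes ?N" for q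
    unfolding P_def by (rule sum_permutes_compose_right[OF that])
  have jensen: "c * exp (l * U_gram n1 n2 (\<lambda>a b. k (p a) (p b)))
      \<le> (\<Sum>s | s permutes ?I. \<Sum>t | t permutes ?J. V (p \<circ> (s \<circ> t)))" for p
  proof -
    define u where "u = l * U_gram n1 n2 (\<lambda>a b. k (p a) (p b))"
    define v where "v q = l * U_paired m n1 (\<lambda>a b. k (p (q a)) (p (q b)))" for q
    have sumv: "(\<Sum>s | s permutes ?I. \<Sum>t | t permutes ?J. v (s \<circ> t)) = c * u"
      using U_gram_average[OF m, of "\<lambda>a b. k (p a) (p b)"]
      by (simp add: u_def v_def c_def sum_distrib_left[symmetric])
    \<comment> \<open>The tangent of \<open>exp\<close> at \<open>u\<close>. Since the values
      \<open>v (s \<circ> t)\<close> average to \<open>u\<close>, summing this bound is Jensen's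
      inequality.\<close>
    have tangent: "exp u * (1 - u) + exp u * v q \<le> exp (v q)" for q
    proof -
      have "exp u * (1 + (v q - u)) \<le> exp u * exp (v q - u)"
        by (intro mult_left_mono exp_ge_add_one_self) auto
      then show ?thesis by (simp add: exp_diff algebra_simps)
    qed
    have "c * exp u = exp u * (1 - u) * c + exp u * (c * u)" by (simp add: algebra_simps)
    also have "\<dots> = (\<Sum>s | s permutes ?I. \<Sum>t | t permutes ?J. exp u * (1 - u) * 1 + exp u * v (s \<circ> t))"
      by (simp only: sum.distrib sum_distrib_left[symmetric] sumv cards)
    also have "\<dots> = (\<Sum>s | s permutes ?I. \<Sum>t | t permutes ?J. exp u * (1 - u) + exp u * v (s \<circ> t))"
      by simp
    also have "\<dots> \<le> (\<Sum>s | s permutes ?I. \<Sum>t | t permutes ?J. exp (v (s \<circ> t)))"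
      by (intro sum_mono tangent)
    finally show ?thesis by (simp add: u_def v_def V_def)
  qed
  have "c * (\<Sum>p\<in>P. exp (l * U_gram n1 n2 (\<lambda>a b. k (p a) (p b))))
      \<le> (\<Sum>p\<in>P. \<Sum>s | s permutes ?I. \<Sum>t | t permutes ?J. V (p \<circ> (s \<circ> t)))"
    unfolding sum_distrib_left by (intro sum_mono jensen)
  also have "\<dots> = (\<Sum>s | s permutes ?I. \<Sum>p\<in>P. \<Sum>t | t permutes ?J. V (p \<circ> (s \<circ> t)))"
    by (rule sum.swap)
  also have "\<dots> = (\<Sum>s | s permutes ?I. \<Sum>t | t permutes ?J. \<Sum>p\<in>P. V (p \<circ> (s \<circ> t)))"
    by (rule sum.cong[OF refl], rule sum.swap)
  also have "\<dots> = (\<Sum>s | s permutes ?I. \<Sum>t | t permutes ?J. \<Sum>p\<in>P. V p)"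
  proof (rule sum.cong[OF refl], rule sum.cong[OF refl], rule reindex)
    fix s t assume "s \<in> {s. s permutes ?I}" "t \<in> {t. t permutes ?J}"
    then have "s permutes ?N" "t permutes ?N"
      using permutes_subset[of s ?I ?N] permutes_subset[of t ?J ?N] by auto
    then show "s \<circ> t permutes ?N" by (simp add: permutes_compose)
  qed
  also have "\<dots> = c * (\<Sum>p\<in>P. V p)"
    unfolding cards[symmetric] by (simp add: sum_distrib_right)
  finally have step1: "(\<Sum>p\<in>P. exp (l * U_gram n1 n2 (\<lambda>a b. k (p a) (p b)))) \<le> (\<Sum>p\<in>P. V p)"
    using c0 by simp
  \<comment> \<open>The coefficients of the chaos in the swaps. The zero diagonal kills the trace,
    so only \<open>exp (1/4)\<close> survives in the bound.\<close>
  define A where "A p i j = (if i = j then 0 else l / (real m * (real m - 1)) *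
     h_gram (\<lambda>a b. k (p a) (p b)) i j (n1 + i) (n1 + j))" for p i j
  have off: "(\<Sum>i\<in>?m. \<Sum>j\<in>?m. if i = j then 0 else f i j) = (\<Sum>(i, j)\<in>off_diag ?m. f i j)"
    for f :: "nat \<Rightarrow> nat \<Rightarrow> real"
  proof -
    have "(\<Sum>i\<in>?m. \<Sum>j\<in>?m. if i = j then 0 else f i j)
      = (\<Sum>z\<in>?m \<times> ?m. if fst z = snd z then 0 else f (fst z) (snd z))"
      by (simp add: sum.cartesian_product case_prod_unfold)
    also have "\<dots> = (\<Sum>z\<in>off_diag ?m. f (fst z) (snd z))"
      by (rule sum.mono_neutral_cong_right) (auto simp: off_diag_def)
    finally show ?thesis by (simp add: case_prod_unfold)
  qed
  have swapped: "V (p \<circ> swap_pairs n1 S) = exp (\<Sum>i\<in>?m. \<Sum>j\<in>?m. A p i j *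
      ((if i \<in> S then 1 else -1) * (if j \<in> S then 1 else -1)))" if S: "S \<in> Pow ?m" for p S
  proof -
    have "l * U_paired m n1 (\<lambda>a b. k ((p \<circ> swap_pairs n1 S) a) ((p \<circ> swap_pairs n1 S) b))
      = (\<Sum>(i, j)\<in>off_diag ?m. l / (real m * (real m - 1)) *
         ((if i \<in> S then 1 else -1) * (if j \<in> S then 1 else -1) *
          h_gram (\<lambda>a b. k (p a) (p b)) i j (n1 + i) (n1 + j)))"
      unfolding U_paired_def times_divide_eq_right sum_divide_distrib sum_distrib_left
      using S m
      by (intro sum.cong refl)
         (auto simp: off_diag_def sym h_gram_swap_pairs[of S m n1 _ _ "\<lambda>a b. k (p a) (p b)"])
    also have "\<dots> = (\<Sum>i\<in>?m. \<Sum>j\<in>?m. A p i j *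
      ((if i \<in> S then 1 else -1) * (if j \<in> S then 1 else -1)))"
      unfolding off[symmetric] A_def by (intro sum.cong refl) auto
    finally show ?thesis unfolding V_def by simp
  qed
  have chaos: "(\<Sum>S\<in>Pow ?m. V (p \<circ> swap_pairs n1 S)) \<le> 2 ^ m * exp (1/4)" if p: "p \<in> P" for p
  proof -
    let ?G = "\<Sum>(a, b)\<in>off_diag ?N. (k a b)\<^sup>2"
    have G0: "?G \<ge> 0" by (intro sum_nonneg) auto
    have "(\<Sum>i\<in>?m. \<Sum>j\<in>?m. (A p i j)\<^sup>2)
       = (\<Sum>i\<in>?m. \<Sum>j\<in>?m. if i = j then 0 else (l / (real m * (real m - 1)))\<^sup>2 *
           (h_gram (\<lambda>a b. k (p a) (p b)) i j (n1 + i) (n1 + j))\<^sup>2)"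
      unfolding A_def by (intro sum.cong refl) (simp add: power_mult_distrib power_divide)
    also have "\<dots> = (l / (real m * (real m - 1)))\<^sup>2 * (\<Sum>(i, j)\<in>off_diag ?m.
           (h_gram (\<lambda>a b. k (p a) (p b)) i j (n1 + i) (n1 + j))\<^sup>2)"
      unfolding off by (simp only: sum_distrib_left case_prod_unfold)
    also have "\<dots> \<le> (l / (real m * (real m - 1)))\<^sup>2 * (16 * (\<Sum>(a, b)\<in>off_diag ?N. (k (p a) (p b))\<^sup>2))"
      by (intro mult_left_mono sum_h_gram_power2_le m) auto
    also have "(\<Sum>(a, b)\<in>off_diag ?N. (k (p a) (p b))\<^sup>2) = ?G"
      using p unfolding P_def by (intro sum_off_diag_permutes[where F = "\<lambda>a b. (k a b)\<^sup>2"]) simp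
    also have "(l / (real m * (real m - 1)))\<^sup>2 * (16 * ?G) = (4 * l * sqrt ?G / (real m * (real m - 1)))\<^sup>2"
      using G0 by (simp add: power_divide power_mult_distrib)
    also have "\<dots> \<le> (1/4)\<^sup>2"
      using l m0 G0 by (intro power_mono) (simp_all add: divide_simps mult_ac)
    finally have "(\<Sum>i\<in>?m. \<Sum>j\<in>?m. (A p i j)\<^sup>2) \<le> (1/4)\<^sup>2" .
    moreover have "A p i j = A p j i" for i j
      unfolding A_def h_gram_def using sym[of "p i"] sym[of "p (n1 + i)"] by simp
    ultimately have "(\<Sum>S\<in>Pow ?m. V (p \<circ> swap_pairs n1 S))
      \<le> 2 ^ card ?m * exp ((\<Sum>i\<in>?m. A p i i) + 1/4)"
      using rademacher_chaos_exp_moment[of ?m "A p" "1/4"] by (simp add: swapped)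
    then show ?thesis by (simp add: A_def)
  qed
  \<comment> \<open>Composing with a swap on the right permutes \<open>P\<close>, so averaging over
    all swaps leaves the sum over \<open>P\<close> unchanged and the chaos bound can be applied for
    each \<open>p\<close> separately.\<close>
  have "2 ^ m * (\<Sum>p\<in>P. V p) = (\<Sum>S\<in>Pow ?m. \<Sum>p\<in>P. V p)"
    by (simp add: card_Pow)
  also have "\<dots> = (\<Sum>S\<in>Pow ?m. \<Sum>p\<in>P. V (p \<circ> swap_pairs n1 S))"
    using m by (intro sum.cong[OF refl] reindex[symmetric] swap_pairs_permutes[of _ m]) auto
  also have "\<dots> = (\<Sum>p\<in>P. \<Sum>S\<in>Pow ?m. V (p \<circ> swap_pairs n1 S))" by (rule sum.swap)
  also have "\<dots> \<le> (\<Sum>p\<in>P. 2 ^ m * exp (1/4))" by (intro sum_mono chaos)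
  also have "\<dots> = 2 ^ m * (fact (n1 + n2) * exp (1/4))"
    by (simp add: P_def card_permutations)
  finally have "(\<Sum>p\<in>P. V p) \<le> fact (n1 + n2) * exp (1/4)" by simp
  with step1 show ?thesis unfolding P_def by linarith
qed

section \<open>The permutation test\<close>

text \<open>The infimum lies below \<open>t0\<close> as soon as some admissible threshold does. With
  finitely many values, the largest one below \<open>t0\<close> can serve as that threshold, which
  turns the weak inequality in the count into a strict one. The bounds on \<open>q\<close> keep the
  set nonempty and bounded below.\<close>

lemma ecdf_inf_less_iff:
  fixes f :: "'i \<Rightarrow> real" and t0 q :: real
  assumes "finite P" "0 < q" "q \<le> real (card P)"
  shows "Inf {t. real (card {p \<in> P. f p \<le> t}) \<ge> q} < t0 \<longleftrightarrow> real (card {p \<in> P. f p < t0}) \<ge> q"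
proof -
  define T where "T = {t. real (card {p \<in> P. f p \<le> t}) \<ge> q}"
  have P0: "P \<noteq> {}" using assms by auto
  have bdd: "bdd_below T"
  proof (rule bdd_belowI)
    fix t assume "t \<in> T"
    then have "{p \<in> P. f p \<le> t} \<noteq> {}" using assms(2) unfolding T_def by (metis (mono_tags) card.empty mem_Collect_eq not_le of_nat_0)
    then obtain p where "p \<in> P" "f p \<le> t" by blast
    then show "Min (f ` P) \<le> t" using assms(1) by (meson Min_le dual_order.trans finite_imageI imageI)
  qed
  have ne: "T \<noteq> {}"
  proof -
    have "{p \<in> P. f p \<le> Max (f ` P)} = P" using assms(1) by auto
    then have "Max (f ` P) \<in> T" using assms(3) by (simp add: T_def)
    then show ?thesis by blast
  qed
  have "Inf T < t0 \<longleftrightarrow> (\<exists>t\<in>T. t < t0)" by (rule cInf_less_iff[OF ne bdd])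
  also have "\<dots> \<longleftrightarrow> real (card {p \<in> P. f p < t0}) \<ge> q"
  proof
    assume "\<exists>t\<in>T. t < t0"
    then obtain t where t: "real (card {p \<in> P. f p \<le> t}) \<ge> q" "t < t0" by (auto simp: T_def)
    have "card {p \<in> P. f p \<le> t} \<le> card {p \<in> P. f p < t0}"
      using t(2) assms(1) by (intro card_mono) auto
    with t(1) show "real (card {p \<in> P. f p < t0}) \<ge> q" by linarith
  next
    assume *: "real (card {p \<in> P. f p < t0}) \<ge> q"
    define S where "S = {p \<in> P. f p < t0}"
    have "card S \<noteq> 0" using * assms(2) unfolding S_def[symmetric] by linarith
    then have S: "finite S" "S \<noteq> {}" by (auto intro: card_ge_0_finite)
    define t where "t = Max (f ` S)"
    have "t \<in> f ` S" unfolding t_def using S by (intro Max_in) auto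
    then have "t < t0" by (auto simp: S_def)
    have "S \<subseteq> {p \<in> P. f p \<le> t}" using S(1) by (auto simp: t_def S_def)
    then have "card S \<le> card {p \<in> P. f p \<le> t}" using assms(1) by (intro card_mono) auto
    then have "t \<in> T" using * unfolding T_def S_def[symmetric] by simp
    with \<open>t < t0\<close> show "\<exists>t\<in>T. t < t0" by blast
  qed
  finally show ?thesis by (simp add: T_def)
qed

text \<open>Replaces the critical value by the rank of the observed statistic among the permuted
  ones. Level, measurability and the acceptance bound all start from this form.\<close>

lemma reject_iff:
  assumes "0 < \<alpha>" "\<alpha> < 1"
  shows "reject bw n1 n2 \<alpha> x \<longleftrightarrow> (1 - \<alpha>) * fact (n1 + n2) \<le> real (card {p. p permutes {1..n1+n2} \<and>
      U_perm bw n1 n2 x p < U_perm bw n1 n2 x id})"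
proof -
  let ?P = "{p. p permutes {1..n1+n2}}"
  have fin: "finite ?P" by (simp add: finite_permutations)
  have "1 / fact (n1 + n2) * (\<Sum>p\<in>?P. of_bool (U_perm bw n1 n2 x p \<le> t)) \<ge> 1 - \<alpha>
      \<longleftrightarrow> real (card {p \<in> ?P. U_perm bw n1 n2 x p \<le> t}) \<ge> (1 - \<alpha>) * fact (n1 + n2)" for t
  proof -
    have "(\<Sum>p\<in>?P. of_bool (U_perm bw n1 n2 x p \<le> t)) = real (card {p \<in> ?P. U_perm bw n1 n2 x p \<le> t})"
      using fin by (simp add: sum.inter_filter[symmetric] of_bool_def Int_def)
    then show ?thesis by (simp add: field_simps)
  qed
  then have "reject bw n1 n2 \<alpha> x \<longleftrightarrow>
      Inf {t. real (card {p \<in> ?P. U_perm bw n1 n2 x p \<le> t}) \<ge> (1 - \<alpha>) * fact (n1 + n2)} < U_perm bw n1 n2 x id"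
    unfolding reject_def perm_crit_def by (simp add: U_perm_def)
  also have "\<dots> \<longleftrightarrow> (1 - \<alpha>) * fact (n1 + n2) \<le> real (card {p \<in> ?P. U_perm bw n1 n2 x p < U_perm bw n1 n2 x id})"
  proof (rule ecdf_inf_less_iff[OF fin])
    show "0 < (1 - \<alpha>) * fact (n1 + n2)" using assms by simp
    show "(1 - \<alpha>) * fact (n1 + n2) \<le> real (card ?P)"
      using assms by (simp add: card_permutations)
  qed
  finally show ?thesis by simp
qed

text \<open>Upon acceptance at least a proportion \<alpha> of the permuted statistics reach the
  observed one. Markov's inequality for the exponential moment over permutations then gives
  \<open>\<alpha> * exp (l * U) \<le> exp (1/4)\<close>, to be solved for \<open>U\<close>.\<close>

lemma not_reject_imp_le:
  fixes bw :: "real^'d"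
  assumes \<alpha>: "0 < \<alpha>" "\<alpha> < exp (-1)" and bw: "\<forall>i. bw $ i > 0"
    and m: "2 \<le> m" "m \<le> n1" "m \<le> n2" and nr: "\<not> reject bw n1 n2 \<alpha> x"
  shows "U_perm bw n1 n2 x id \<le> 20 * ln (1 / \<alpha>) / (real m * (real m - 1)) *
     sqrt (\<Sum>(a, b)\<in>off_diag {1..n1 + n2}. (gauss_kernel bw (x a - x b))\<^sup>2)"
proof -
  let ?P = "{p. p permutes {1..n1+n2}}" and ?U = "U_perm bw n1 n2 x"
  define k where "k a b = gauss_kernel bw (x a - x b)" for a b
  define G where "G = (\<Sum>(a, b)\<in>off_diag {1..n1 + n2}. (k a b)\<^sup>2)"
  \<comment> \<open>The largest exponent that the exponential moment bound admits.\<close>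
  define l where "l = real m * (real m - 1) / (16 * sqrt G)"
  have fin: "finite ?P" by (simp add: finite_permutations)
  have \<alpha>1: "\<alpha> < 1" using \<alpha> by (smt (verit) exp_le_one_iff)
  have "ln \<alpha> < ln (exp (-1))" using \<alpha> by (subst ln_less_cancel_iff) auto
  then have A: "ln (1 / \<alpha>) > 1" using \<alpha> by (simp add: ln_div)
  have kpos: "k a b > 0" for a b
    using bw unfolding k_def gauss_kernel_def by (intro mult_pos_pos divide_pos_pos prod_pos) auto
  have sym: "k a b = k b a" for a b
    unfolding k_def gauss_kernel_def by (simp add: power2_commute)
  \<comment> \<open>The Gaussian kernel never vanishes, so the division by \<open>sqrt G\<close> in
    \<open>l\<close> is genuine.\<close>
  have "G > 0" unfolding G_def
  proof (rule sum_pos)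
    have "(1, 2) \<in> off_diag {1..n1+n2}" using m by (simp add: off_diag_def)
    then show "off_diag {1..n1+n2} \<noteq> {}" by blast
  qed (use kpos in \<open>auto simp: less_imp_neq[THEN not_sym]\<close>)
  have m0: "real m * (real m - 1) > 0" using m by simp
  have l0: "l > 0" unfolding l_def using m0 \<open>G > 0\<close> by simp
  have "(\<Sum>p\<in>?P. exp (l * ?U p)) \<le> fact (n1 + n2) * exp (1/4)"
    unfolding U_perm_eq_U_gram k_def[symmetric]
  proof (rule permutation_exp_moment[OF m, of k])
    show "16 * l * sqrt (\<Sum>(a, b)\<in>off_diag {1..n1 + n2}. (k a b)\<^sup>2) \<le> real m * (real m - 1)"
      unfolding G_def[symmetric] l_def using \<open>G > 0\<close> by simp
  qed (use l0 sym in auto)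
  moreover have "\<alpha> * fact (n1 + n2) * exp (l * ?U id) \<le> (\<Sum>p\<in>?P. exp (l * ?U p))"
  proof -
    define S where "S = {p \<in> ?P. ?U id \<le> ?U p}"
    define L where "L = {p \<in> ?P. ?U p < ?U id}"
    have LS: "?P = L \<union> S" by (auto simp: L_def S_def)
    have "card (L \<union> S) = card L + card S"
      using fin by (intro card_Un_disjoint) (auto simp: L_def S_def)
    moreover have "card ?P = fact (n1 + n2)" by (simp add: card_permutations)
    ultimately have "card L + card S = fact (n1 + n2)" unfolding LS by simp
    then have "real (card L) + real (card S) = fact (n1 + n2)"
      unfolding of_nat_add[symmetric] by simp
    moreover have "real (card L) < (1 - \<alpha>) * fact (n1 + n2)"
      using nr reject_iff[OF \<alpha>(1) \<alpha>1, of bw n1 n2 x] by (simp add: L_def)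
    ultimately have "\<alpha> * fact (n1 + n2) \<le> real (card S)" by (simp add: algebra_simps)
    then have "\<alpha> * fact (n1 + n2) * exp (l * ?U id) \<le> (\<Sum>p\<in>S. exp (l * ?U id))"
      by simp
    also have "\<dots> \<le> (\<Sum>p\<in>S. exp (l * ?U p))"
      using l0 by (intro sum_mono) (simp add: S_def)
    also have "\<dots> \<le> (\<Sum>p\<in>?P. exp (l * ?U p))"
      using fin by (intro sum_mono2) (auto simp: S_def)
    finally show ?thesis .
  qed
  ultimately have "\<alpha> * fact (n1 + n2) * exp (l * ?U id) \<le> fact (n1 + n2) * exp (1/4)"
    by linarith
  then have "fact (n1 + n2) * (\<alpha> * exp (l * ?U id)) \<le> fact (n1 + n2) * exp (1/4)"
    by (simp only: mult_ac)
  then have "\<alpha> * exp (l * ?U id) \<le> exp (1/4)" by simp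
  then have "ln (\<alpha> * exp (l * ?U id)) \<le> ln (exp (1/4))" using \<alpha> by (subst ln_le_cancel_iff) auto
  then have "l * ?U id \<le> 1/4 + ln (1 / \<alpha>)" using \<alpha> by (simp add: ln_mult ln_div)
  \<comment> \<open>Here \<alpha> < 1/e enters, through ln (1 / \<alpha>) > 1. The constant 20 is
    5/4 times the 16 in \<open>l\<close>.\<close>
  also have "\<dots> \<le> 5/4 * ln (1 / \<alpha>)" using A by simp
  finally have "?U id \<le> 5/4 * ln (1 / \<alpha>) / l" using l0 by (simp add: field_simps)
  also have "\<dots> = 20 * ln (1 / \<alpha>) / (real m * (real m - 1)) * sqrt G"
    unfolding l_def by simp
  finally show ?thesis unfolding G_def k_def .
qed

section \<open>Ranks, relabelling and the level of the test\<close>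

lemma card_high_rank_le:
  fixes f :: "'i \<Rightarrow> real"
  assumes "finite P" "c \<le> real (card P)"
  shows "real (card {q \<in> P. c \<le> real (card {p \<in> P. f p < f q})}) \<le> real (card P) - c"
proof (cases "{q \<in> P. c \<le> real (card {p \<in> P. f p < f q})} = {}")
  case True
  then show ?thesis using assms by (simp only: True) simp
next
  case False
  define H where "H = {q \<in> P. c \<le> real (card {p \<in> P. f p < f q})}"
  have H: "finite H" "H \<noteq> {}" "H \<subseteq> P" using False assms by (auto simp: H_def)
  \<comment> \<open>The member of \<open>H\<close> with the least value: the at least
    \<open>c\<close> elements strictly below it all lie outside \<open>H\<close>.\<close>
  obtain q where q: "q \<in> H" "\<And>h. h \<in> H \<Longrightarrow> f q \<le> f h"
    using arg_min_if_finite[OF H(1,2), of f] by (metis linorder_not_less)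
  have "card (H \<union> {p \<in> P. f p < f q}) = card H + card {p \<in> P. f p < f q}"
    using H assms q(2) by (intro card_Un_disjoint) (auto simp: not_less[symmetric])
  moreover have "card (H \<union> {p \<in> P. f p < f q}) \<le> card P"
    using H assms by (intro card_mono) auto
  moreover have "c \<le> real (card {p \<in> P. f p < f q})" using q(1) by (simp add: H_def)
  ultimately show ?thesis unfolding H_def[symmetric] by linarith
qed

lemma U_gram_cong:
  assumes "\<And>a b. a \<in> {1..n1+n2} \<Longrightarrow> b \<in> {1..n1+n2} \<Longrightarrow> k a b = k' a b"
  shows "U_gram n1 n2 k = U_gram n1 n2 k'"
  unfolding U_gram_def h_gram_def
  by (intro arg_cong2[of _ _ _ _ "(/)"] refl sum.cong prod.case_cong) (auto simp: off_diag_def assms)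

text \<open>Points of the product space are extensional, so a relabelled sample must be restricted
  to the index set. The restriction is invisible here because \<open>p\<close> maps that set to
  itself.\<close>

lemma U_perm_restrict:
  assumes "p permutes {1..n1+n2}"
  shows "U_perm bw n1 n2 (\<lambda>i\<in>{1..n1+n2}. x (q i)) p = U_perm bw n1 n2 x (q \<circ> p)"
proof -
  have "p a \<in> {1..n1+n2}" if "a \<in> {1..n1+n2}" for a
    using permutes_in_image[OF assms] that by blast
  then show ?thesis
    unfolding U_perm_eq_U_gram by (intro U_gram_cong) simp
qed

lemma borel_measurable_gauss_kernel [measurable]: "gauss_kernel bw \<in> borel_measurable borel"
  unfolding gauss_kernel_def by measurable

lemma U_perm_measurable:
  assumes "\<And>i. i \<in> {1..n1+n2} \<Longrightarrow> sets (M i) = sets borel" "p permutes {1..n1+n2}"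
  shows "(\<lambda>x. U_perm bw n1 n2 x p) \<in> borel_measurable (Pi\<^sub>M {1..n1+n2} M)"
proof -
  have comp: "(\<lambda>x. x (p a)) \<in> borel_measurable (Pi\<^sub>M {1..n1+n2} M)" if "a \<in> {1..n1+n2}" for a
  proof -
    have "p a \<in> {1..n1+n2}" using permutes_in_image[OF assms(2)] that by blast
    then show ?thesis
      using measurable_component_singleton[of "p a" "{1..n1+n2}" M] measurable_cong_sets[OF refl assms(1)[of "p a"]]
      by blast
  qed
  have "(\<lambda>x. gauss_kernel bw (x (p a) - x (p b))) \<in> borel_measurable (Pi\<^sub>M {1..n1+n2} M)"
    if "a \<in> {1..n1+n2}" "b \<in> {1..n1+n2}" for a b
    by (intro measurable_compose[OF _ borel_measurable_gauss_kernel] borel_measurable_diff comp that)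
  then show ?thesis
    unfolding U_perm_eq_U_gram U_gram_def h_gram_def case_prod_unfold
    by (intro borel_measurable_divide borel_measurable_sum borel_measurable_diff borel_measurable_add borel_measurable_const)
       (auto simp: off_diag_def)
qed

text \<open>In rank form the event is a condition on a finite sum of indicators, which avoids the
  infimum in the critical value.\<close>

lemma reject_measurable:
  assumes "\<And>i. i \<in> {1..n1+n2} \<Longrightarrow> sets (M i) = sets borel" "0 < \<alpha>" "\<alpha> < 1"
  shows "{x \<in> space (Pi\<^sub>M {1..n1+n2} M). reject bw n1 n2 \<alpha> x} \<in> sets (Pi\<^sub>M {1..n1+n2} M)"
proof -
  let ?P = "{p. p permutes {1..n1+n2}}"
  have fin: "finite ?P" by (simp add: finite_permutations)
  have card: "real (card {p. p permutes {1..n1+n2} \<and> U_perm bw n1 n2 x p < U_perm bw n1 n2 x id})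
    = (\<Sum>p\<in>?P. if U_perm bw n1 n2 x p < U_perm bw n1 n2 x id then 1 else 0)" for x
    using fin by (simp add: sum.inter_filter[symmetric])
  have [measurable]: "(\<lambda>x. U_perm bw n1 n2 x p) \<in> borel_measurable (Pi\<^sub>M {1..n1+n2} M)" if "p \<in> ?P" for p
    using that by (intro U_perm_measurable assms) auto
  have [measurable]: "(\<lambda>x. U_perm bw n1 n2 x id) \<in> borel_measurable (Pi\<^sub>M {1..n1+n2} M)"
    by (intro U_perm_measurable assms permutes_id)
  show ?thesis
    unfolding reject_iff[OF assms(2,3)] card by measurable
qed

lemma permutation_test_level:
  fixes Q :: "(real^'d) measure"
  assumes Q: "prob_space Q" "sets Q = sets borel" and \<alpha>: "0 < \<alpha>" "\<alpha> < 1"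
  shows "measure (Pi\<^sub>M {1..n1+n2} (\<lambda>_. Q)) {x \<in> space (Pi\<^sub>M {1..n1+n2} (\<lambda>_. Q)). reject bw n1 n2 \<alpha> x} \<le> \<alpha>"
proof -
  let ?I = "{1..n1+n2}" and ?P = "{p. p permutes {1..n1+n2}}"
  define M where "M = Pi\<^sub>M ?I (\<lambda>_. Q)"
  define R where "R = {x \<in> space M. reject bw n1 n2 \<alpha> x}"
  define t where "t q x = (\<lambda>i\<in>?I. x (q i))" for q :: "nat \<Rightarrow> nat" and x :: "nat \<Rightarrow> real^'d"
  interpret M: prob_space M unfolding M_def by (intro prob_space_PiM Q)
  have fin: "finite ?P" and cardP: "real (card ?P) = fact (n1 + n2)"
    by (simp_all add: finite_permutations card_permutations)
  have R [measurable]: "R \<in> sets M"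
    unfolding R_def M_def using Q \<alpha> by (intro reject_measurable) auto
  have t [measurable]: "t q \<in> measurable M M" and dt: "distr M M (t q) = M" if "q \<in> ?P" for q
  proof -
    have q: "inj_on q ?I" "q \<in> ?I \<rightarrow> ?I"
      using that permutes_in_image[of q ?I] by (auto intro: permutes_inj_on)
    show "distr M M (t q) = M"
      using distr_PiM_reindex[of ?I "\<lambda>_. Q", OF _ q] Q unfolding M_def t_def by simp
    show "t q \<in> measurable M M"
      unfolding M_def t_def using q by (intro measurable_restrict measurable_component_singleton) auto
  qed
  have rej: "reject bw n1 n2 \<alpha> (t q x) \<longleftrightarrow>
      (1 - \<alpha>) * fact (n1 + n2) \<le> real (card {p \<in> ?P. U_perm bw n1 n2 x p < U_perm bw n1 n2 x q})"
    if q: "q \<in> ?P" for q x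
  proof -
    have pr: "U_perm bw n1 n2 (t q x) p = U_perm bw n1 n2 x (q \<circ> p)" if "p permutes ?I" for p
      unfolding t_def by (rule U_perm_restrict[OF that])
    have "{p. p permutes ?I \<and> U_perm bw n1 n2 (t q x) p < U_perm bw n1 n2 (t q x) id}
      = {p \<in> ?P. U_perm bw n1 n2 x (q \<circ> p) < U_perm bw n1 n2 x q}"
      using pr pr[OF permutes_id] by auto
    \<comment> \<open>Composing with \<open>q\<close> on the left matches the permuted statistics of
      the relabelled sample with those of \<open>x\<close>. Only the value they are compared with
      depends on \<open>q\<close>.\<close>
    moreover have "bij_betw ((\<circ>) q) {p \<in> ?P. U_perm bw n1 n2 x (q \<circ> p) < U_perm bw n1 n2 x q}
       {p \<in> ?P. U_perm bw n1 n2 x p < U_perm bw n1 n2 x q}"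
    proof (rule bij_betw_byWitness[where f' = "(\<circ>) (inv q)"])
      have iq: "inv q permutes ?I" using q by (simp add: permutes_inv)
      have c: "inv q \<circ> (q \<circ> p) = p" "q \<circ> (inv q \<circ> p) = p" for p
        using q by (simp_all add: o_assoc permutes_inv_o)
      show "\<forall>p\<in>{p \<in> ?P. U_perm bw n1 n2 x (q \<circ> p) < U_perm bw n1 n2 x q}. inv q \<circ> (q \<circ> p) = p"
        "\<forall>p\<in>{p \<in> ?P. U_perm bw n1 n2 x p < U_perm bw n1 n2 x q}. q \<circ> (inv q \<circ> p) = p"
        unfolding c by blast+
      show "(\<circ>) q ` {p \<in> ?P. U_perm bw n1 n2 x (q \<circ> p) < U_perm bw n1 n2 x q}
          \<subseteq> {p \<in> ?P. U_perm bw n1 n2 x p < U_perm bw n1 n2 x q}"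
        using q by (auto intro: permutes_compose)
      show "(\<circ>) (inv q) ` {p \<in> ?P. U_perm bw n1 n2 x p < U_perm bw n1 n2 x q}
          \<subseteq> {p \<in> ?P. U_perm bw n1 n2 x (q \<circ> p) < U_perm bw n1 n2 x q}"
        using iq by (auto simp: c intro: permutes_compose)
    qed
    ultimately show ?thesis
      unfolding reject_iff[OF \<alpha>] by (simp add: bij_betw_same_card)
  qed
  have "fact (n1 + n2) * M.prob R = (\<Sum>q\<in>?P. M.prob R)" using cardP by simp
  also have "\<dots> = (\<Sum>q\<in>?P. M.prob (t q -` R \<inter> space M))"
  proof (rule sum.cong[OF refl])
    fix q assume q: "q \<in> ?P"
    have "measure (distr M M (t q)) R = M.prob (t q -` R \<inter> space M)"
      using q by (intro measure_distr) auto
    then show "M.prob R = M.prob (t q -` R \<inter> space M)" using dt[OF q] by simp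
  qed
  also have "\<dots> = (\<Sum>q\<in>?P. M.expectation (indicator (t q -` R \<inter> space M)))"
    by (intro sum.cong refl) (simp add: Int_commute)
  also have "\<dots> = M.expectation (\<lambda>x. \<Sum>q\<in>?P. indicator (t q -` R \<inter> space M) x)"
    by (rule Bochner_Integration.integral_sum[symmetric])
       (auto intro!: integrable_real_indicator simp: M.emeasure_eq_measure)
  \<comment> \<open>The bound holds pointwise: whatever \<open>x\<close> is, at most
    \<open>\<alpha> * fact (n1 + n2)\<close> of its relabellings lead to rejection.\<close>
  also have "\<dots> \<le> M.expectation (\<lambda>x. \<alpha> * fact (n1 + n2))"
  proof (rule integral_mono)
    fix x assume x: "x \<in> space M"
    have "(\<Sum>q\<in>?P. indicator (t q -` R \<inter> space M) x :: real)
       = (\<Sum>q\<in>?P. if reject bw n1 n2 \<alpha> (t q x) then 1 else 0)"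
      using x measurable_space[OF t] by (intro sum.cong refl) (auto simp: R_def indicator_def)
    also have "\<dots> = real (card {q \<in> ?P. (1 - \<alpha>) * fact (n1 + n2) \<le>
        real (card {p \<in> ?P. U_perm bw n1 n2 x p < U_perm bw n1 n2 x q})})"
    proof -
      have "{q \<in> ?P. reject bw n1 n2 \<alpha> (t q x)} = {q \<in> ?P. (1 - \<alpha>) * fact (n1 + n2) \<le>
        real (card {p \<in> ?P. U_perm bw n1 n2 x p < U_perm bw n1 n2 x q})}"
        using rej by blast
      moreover have "(\<Sum>q\<in>?P. if reject bw n1 n2 \<alpha> (t q x) then 1 else 0) = real (card {q \<in> ?P. reject bw n1 n2 \<alpha> (t q x)})"
        using fin by (simp add: sum.inter_filter[symmetric])
      ultimately show ?thesis by simp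
    qed
    also have "\<dots> \<le> fact (n1 + n2) - (1 - \<alpha>) * fact (n1 + n2)"
      using card_high_rank_le[OF fin, of "(1 - \<alpha>) * fact (n1 + n2)"] \<alpha> cardP by simp
    also have "\<dots> = \<alpha> * fact (n1 + n2)" by (simp add: algebra_simps)
    finally show "(\<Sum>q\<in>?P. indicator (t q -` R \<inter> space M) x) \<le> \<alpha> * fact (n1 + n2)" .
  qed (auto intro!: integrable_real_indicator simp: M.emeasure_eq_measure)
  also have "\<dots> = \<alpha> * fact (n1 + n2)" by (simp add: M.prob_space)
  finally have "M.prob R \<le> \<alpha>" by (simp add: mult.commute)
  then show ?thesis unfolding R_def M_def .
qed

section \<open>Moments of kernel sums\<close>

text \<open>Inner integrals that do not exist are \<open>0\<close>, hence at most \<open>c\<close>.\<close>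

lemma (in product_prob_space) integral_coordinate_le:
  assumes "finite I" "i \<in> I" "integrable (Pi\<^sub>M I M) f" "0 \<le> c"
    and "\<And>x. (\<integral>y. f (x(i := y)) \<partial>M i) \<le> (c :: real)"
  shows "(\<integral>x. f x \<partial>Pi\<^sub>M I M) \<le> c"
proof -
  interpret J: prob_space "Pi\<^sub>M (I - {i}) M" by (intro prob_space_PiM prob_space)
  have "insert i (I - {i}) = I" using assms(2) by auto
  then have "(\<integral>x. f x \<partial>Pi\<^sub>M I M) = (\<integral>x. (\<integral>y. f (x(i := y)) \<partial>M i) \<partial>Pi\<^sub>M (I - {i}) M)"
    using product_integral_insert[of "I - {i}" i f] assms by simp
  also have "\<dots> \<le> (\<integral>x. c \<partial>Pi\<^sub>M (I - {i}) M)"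
    using assms by (intro integral_mono') auto
  finally show ?thesis by (simp add: J.prob_space)
qed

lemma (in product_prob_space) integral_coordinate_zero:
  fixes f :: "_ \<Rightarrow> real"
  assumes "finite I" "i \<in> I" "integrable (Pi\<^sub>M I M) f"
    and "\<And>x. (\<integral>y. f (x(i := y)) \<partial>M i) = 0"
  shows "(\<integral>x. f x \<partial>Pi\<^sub>M I M) = 0"
proof -
  have "insert i (I - {i}) = I" using assms(2) by auto
  then show ?thesis
    using product_integral_insert[of "I - {i}" i f] assms by simp
qed

text \<open>Two bounds on the kernel are kept apart, \<open>B\<close> for its size and
  \<open>M\<close> for its mean in one argument. Second moments then come out as multiples of
  \<open>M * B\<close>; for small bandwidths \<open>B\<close> is large while \<open>M\<close> is the
  fixed density bound.\<close>

locale kernel_sample =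
  fixes \<mu> :: "nat \<Rightarrow> 'a :: topological_space measure" and I :: "nat set"
    and g :: "'a \<Rightarrow> 'a \<Rightarrow> real" and B M :: real
  assumes finite_I [simp]: "finite I"
    and prob_space_\<mu>: "\<And>a. prob_space (\<mu> a)"
    and sets_\<mu> [measurable_cong, simp]: "\<And>a. sets (\<mu> a) = sets borel"
    and g_measurable [measurable]: "case_prod g \<in> borel_measurable (borel \<Otimes>\<^sub>M borel)"
    and g_sym: "\<And>x y. g x y = g y x"
    and g_nonneg: "\<And>x y. 0 \<le> g x y" and g_le: "\<And>x y. g x y \<le> B"
    and g_mean_le: "\<And>a x. (\<integral>y. g x y \<partial>\<mu> a) \<le> M"
begin

sublocale product_prob_space \<mu> I
  by (simp add: product_prob_space_def product_prob_space_axioms_def product_sigma_finite_def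
      prob_space_\<mu> prob_space_imp_sigma_finite)

abbreviation PM :: "(nat \<Rightarrow> 'a) measure" where "PM \<equiv> Pi\<^sub>M I \<mu>"

definition proj :: "nat \<Rightarrow> 'a \<Rightarrow> real" where
  "proj b t = (\<integral>y. g t y \<partial>\<mu> b)"

definition mean :: "nat \<Rightarrow> nat \<Rightarrow> real" where
  "mean a b = (\<integral>t. proj b t \<partial>\<mu> a)"

text \<open>The doubly centred kernel of the Hoeffding decomposition, for \<open>s\<close> with law
  \<open>\<mu> a\<close> and \<open>t\<close> with law \<open>\<mu> b\<close>.\<close>

definition degen :: "nat \<Rightarrow> nat \<Rightarrow> 'a \<Rightarrow> 'a \<Rightarrow> real" where
  "degen a b s t = g s t - proj b s - proj a t + mean a b"

lemma space_\<mu> [simp]: "space (\<mu> a) = UNIV"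
  using sets_eq_imp_space_eq[OF sets_\<mu>[of a]] by simp

lemma measure_\<mu>_UNIV [simp]: "measure (\<mu> a) UNIV = 1"
  using M.prob_space[of a] by simp

lemma B_nonneg: "0 \<le> B" using g_nonneg g_le by (rule order_trans)

lemma g_measurable2 [measurable (raw)]:
  assumes "f \<in> borel_measurable N" "h \<in> borel_measurable N"
  shows "(\<lambda>x. g (f x) (h x)) \<in> borel_measurable N"
  using measurable_compose[OF measurable_Pair[OF assms] g_measurable] by simp

lemma integrable_bounded:
  assumes "f \<in> borel_measurable borel" "\<And>x. \<bar>f x\<bar> \<le> C"
  shows "integrable (\<mu> a) (f :: 'a \<Rightarrow> real)"
  using assms by (intro M.integrable_const_bound[of _ C]) auto

lemma integral_le_bound:
  assumes "f \<in> borel_measurable borel" "\<And>x. 0 \<le> f x" "\<And>x. f x \<le> C"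
  shows "(\<integral>x. f x \<partial>\<mu> a) \<le> (C :: real)"
proof -
  have "integrable (\<mu> a) f" using assms by (intro integrable_bounded[of _ C]) auto
  then show ?thesis using assms by (intro M.integral_le_const) auto
qed

lemma proj_measurable [measurable]: "proj b \<in> borel_measurable borel"
  unfolding proj_def by measurable

lemma proj_bounds: "0 \<le> proj b t" "proj b t \<le> B" "proj b t \<le> M"
proof -
  show "0 \<le> proj b t" unfolding proj_def using g_nonneg by simp
  show "proj b t \<le> B" unfolding proj_def by (rule integral_le_bound) (simp_all add: g_nonneg g_le)
  show "proj b t \<le> M" unfolding proj_def by (rule g_mean_le)
qed

lemma mean_bounds: "0 \<le> mean a b" "mean a b \<le> B" "mean a b \<le> M"
proof -
  show "0 \<le> mean a b" unfolding mean_def using proj_bounds(1) by simp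
  show "mean a b \<le> B" "mean a b \<le> M"
    unfolding mean_def by (rule integral_le_bound; simp add: proj_bounds)+
qed

lemma M_nonneg: "0 \<le> M" using proj_bounds(1,3) by (rule order_trans)

lemma mean_sym: "mean a b = mean b a"
proof -
  interpret ab: pair_prob_space "\<mu> a" "\<mu> b" ..
  have "integrable (\<mu> a \<Otimes>\<^sub>M \<mu> b) (case_prod g)"
    using g_nonneg g_le by (intro ab.integrable_const_bound[of _ B]) auto
  then have "(\<integral>y. (\<integral>x. g x y \<partial>\<mu> a) \<partial>\<mu> b) = (\<integral>x. (\<integral>y. g x y \<partial>\<mu> b) \<partial>\<mu> a)"
    by (rule ab.Fubini_integral)
  then show ?thesis unfolding mean_def proj_def using g_sym by (simp cong: Bochner_Integration.integral_cong)
qed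

lemma degen_sym: "degen a b s t = degen b a t s"
  unfolding degen_def using g_sym[of s t] mean_sym[of a b] by simp

lemma degen_measurable [measurable (raw)]:
  assumes [measurable]: "f \<in> borel_measurable N" "h \<in> borel_measurable N"
  shows "(\<lambda>x. degen a b (f x) (h x)) \<in> borel_measurable N"
  unfolding degen_def by measurable

lemma degen_bound: "\<bar>degen a b s t\<bar> \<le> 2 * B"
  unfolding degen_def using g_nonneg[of s t] g_le[of s t] proj_bounds[of b s] proj_bounds[of a t] mean_bounds[of a b]
  by linarith

lemma integral_degen: "(\<integral>s. degen a b s t \<partial>\<mu> a) = 0"
proof -
  have i: "integrable (\<mu> a) (\<lambda>s. g s t)" "integrable (\<mu> a) (proj b)"
    using g_nonneg g_le proj_bounds by (auto intro!: integrable_bounded[of _ B])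
  have "(\<integral>s. g s t \<partial>\<mu> a) = proj a t" unfolding proj_def using g_sym by (simp cong: Bochner_Integration.integral_cong)
  then show ?thesis
    unfolding degen_def using i by (simp add: mean_def[symmetric] M.prob_space)
qed

text \<open>One factor \<open>g s t\<close> is kept so that its later integration yields
  \<open>M\<close> instead of \<open>B\<close>. The three other terms lie between 0 and both
  \<open>M\<close> and \<open>B\<close>, so each of their squares is at most
  \<open>M * B\<close>.\<close>

lemma degen_power2_le: "(degen a b s t)\<^sup>2 \<le> 4 * B * g s t + 12 * (M * B)"
proof -
  have sq: "u\<^sup>2 \<le> M * B" if "0 \<le> u" "u \<le> M" "u \<le> B" for u :: real
    unfolding power2_eq_square using that by (intro mult_mono) auto
  have "(g s t)\<^sup>2 \<le> B * g s t"
    unfolding power2_eq_square using g_nonneg g_le by (intro mult_right_mono) auto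
  moreover have "(degen a b s t)\<^sup>2 \<le> 4 * ((g s t)\<^sup>2 + (mean a b)\<^sup>2 + (proj b s)\<^sup>2 + (proj a t)\<^sup>2)"
    using sum_power2_4_le[of "g s t" "mean a b" "proj b s" "proj a t"] by (simp add: degen_def algebra_simps)
  ultimately show ?thesis
    using sq[of "mean a b"] sq[of "proj b s"] sq[of "proj a t"] proj_bounds mean_bounds by fastforce
qed

lemma integral_degen_power2_le: "(\<integral>s. (degen a b s t)\<^sup>2 \<partial>\<mu> a) \<le> 16 * (M * B)"
proof -
  have i: "integrable (\<mu> a) (\<lambda>s. g s t)"
    using g_nonneg g_le by (auto intro!: integrable_bounded[of _ B])
  have "(\<integral>s. (degen a b s t)\<^sup>2 \<partial>\<mu> a) \<le> (\<integral>s. 4 * B * g s t + 12 * (M * B) \<partial>\<mu> a)"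
    using i degen_power2_le g_nonneg B_nonneg M_nonneg by (intro integral_mono') auto
  also have "\<dots> = 4 * B * proj a t + 12 * (M * B)"
    using i g_sym by (simp add: M.prob_space proj_def cong: Bochner_Integration.integral_cong)
  also have "4 * B * proj a t \<le> 4 * B * M"
    using proj_bounds B_nonneg by (intro mult_left_mono) auto
  finally show ?thesis by (simp add: mult.commute)
qed

lemma coord_measurable [measurable (raw)]: "a \<in> I \<Longrightarrow> (\<lambda>x. x a) \<in> borel_measurable PM"
  using measurable_component_singleton[of a I \<mu>] measurable_cong_sets[OF refl sets_\<mu>] by blast

lemma integrable_PM:
  assumes "f \<in> borel_measurable PM" "\<And>x. \<bar>f x\<bar> \<le> C"
  shows "integrable PM (f :: _ \<Rightarrow> real)"
  using assms by (intro P.integrable_const_bound[of _ C]) auto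

text \<open>Two different unordered pairs leave one of \<open>a\<close>, \<open>b\<close> outside
  \<open>{c, d}\<close>. Integrating out that coordinate first annihilates the first factor.\<close>

lemma degen_orthogonal:
  assumes z: "(a, b) \<in> off_diag I" "(c, d) \<in> off_diag I" "(c, d) \<noteq> (a, b)" "(c, d) \<noteq> (b, a)"
  shows "(\<integral>x. degen a b (x a) (x b) * degen c d (x c) (x d) \<partial>PM) = 0"
proof -
  have *: "(\<integral>x. degen a b (x a) (x b) * degen c d (x c) (x d) \<partial>PM) = 0"
    if "a \<in> I" "b \<in> I" "c \<in> I" "d \<in> I" "a \<noteq> b" "a \<noteq> c" "a \<noteq> d" for a b c d
  proof (rule integral_coordinate_zero[of a])
    have "\<bar>degen a b (x a) (x b) * degen c d (x c) (x d)\<bar> \<le> 2 * B * (2 * B)" for x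
      unfolding abs_mult using degen_bound B_nonneg by (intro mult_mono) auto
    then show "integrable PM (\<lambda>x. degen a b (x a) (x b) * degen c d (x c) (x d))"
      using that by (intro integrable_PM[of _ "2 * B * (2 * B)"]) auto
    show "(\<integral>y. degen a b ((x(a := y)) a) ((x(a := y)) b) * degen c d ((x(a := y)) c) ((x(a := y)) d) \<partial>\<mu> a) = 0" for x
      using that integral_degen[of a b "x b"] by simp
  qed (use that in auto)
  consider "a \<noteq> c" "a \<noteq> d" | "b \<noteq> c" "b \<noteq> d" using z by (auto simp: off_diag_def)
  then show ?thesis
  proof cases
    case 1
    then show ?thesis using z by (intro *) (auto simp: off_diag_def)
  next
    case 2
    then have "(\<integral>x. degen b a (x b) (x a) * degen c d (x c) (x d) \<partial>PM) = 0"
      using z by (intro *) (auto simp: off_diag_def)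
    then show ?thesis using degen_sym by simp
  qed
qed

lemma degen_second_moment_le:
  assumes "(a, b) \<in> off_diag I"
  shows "(\<integral>x. (degen a b (x a) (x b))\<^sup>2 \<partial>PM) \<le> 16 * (M * B)"
proof (rule integral_coordinate_le[of a])
  have ab: "a \<in> I" "b \<in> I" "a \<noteq> b" using assms by (auto simp: off_diag_def)
  then show "a \<in> I" "finite I" by auto
  have "\<bar>(degen a b (x a) (x b))\<^sup>2\<bar> \<le> (2 * B)\<^sup>2" for x
    using power_mono[OF degen_bound[of a b "x a" "x b"] abs_ge_zero, of 2] by simp
  then show "integrable PM (\<lambda>x. (degen a b (x a) (x b))\<^sup>2)"
    using ab by (intro integrable_PM[of _ "(2 * B)\<^sup>2"]) auto
  show "(\<integral>y. (degen a b ((x(a := y)) a) ((x(a := y)) b))\<^sup>2 \<partial>\<mu> a) \<le> 16 * (M * B)" for x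
    using ab integral_degen_power2_le[of a b "x b"] by simp
qed (use M_nonneg B_nonneg in auto)

text \<open>A pair correlates only with itself and with its reversal, hence twice the bound 16 for a
  single term and linear growth in \<open>card Z\<close>.\<close>

lemma sum_degen_second_moment_le:
  assumes Z: "Z \<subseteq> off_diag I"
  shows "(\<integral>x. (\<Sum>(a, b)\<in>Z. degen a b (x a) (x b))\<^sup>2 \<partial>PM) \<le> 32 * (M * B) * real (card Z)"
proof -
  define D where "D z x = degen (fst z) (snd z) (x (fst z)) (x (snd z))" for z x
  have fin: "finite Z" using Z by (rule finite_subset) simp
  have [measurable]: "D z \<in> borel_measurable PM" if "z \<in> Z" for z
    using that Z unfolding D_def off_diag_def by (auto intro!: degen_measurable coord_measurable)
  have bound: "\<bar>D z x\<bar> \<le> 2 * B" for z x unfolding D_def by (rule degen_bound)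
  have int: "integrable PM (\<lambda>x. D z x * D z' x)" if "z \<in> Z" "z' \<in> Z" for z z'
  proof (rule integrable_PM)
    show "\<bar>D z x * D z' x\<bar> \<le> 2 * B * (2 * B)" for x
      unfolding abs_mult using bound B_nonneg by (intro mult_mono) auto
  qed (use that in measurable)
  have MB: "0 \<le> M * B" using M_nonneg B_nonneg by simp
  have row: "(\<Sum>z'\<in>Z. \<integral>x. D z x * D z' x \<partial>PM) \<le> 32 * (M * B)" if z: "z \<in> Z" for z
  proof -
    let ?T = "Z \<inter> {z, (snd z, fst z)}"
    have "(\<Sum>z'\<in>Z. \<integral>x. D z x * D z' x \<partial>PM) = (\<Sum>z'\<in>?T. \<integral>x. D z x * D z' x \<partial>PM)"
    proof (rule sum.mono_neutral_right[OF fin])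
      show "\<forall>z'\<in>Z - ?T. (\<integral>x. D z x * D z' x \<partial>PM) = 0"
        unfolding D_def using Z z by (auto intro!: degen_orthogonal)
    qed auto
    also have "\<dots> \<le> (\<Sum>z'\<in>?T. 16 * (M * B))"
    proof (rule sum_mono)
      fix z' assume "z' \<in> ?T"
      then have eq: "D z' = D z" unfolding D_def using degen_sym by (auto simp: fun_eq_iff)
      have "(fst z, snd z) \<in> off_diag I" using Z z by auto
      from degen_second_moment_le[OF this] show "(\<integral>x. D z x * D z' x \<partial>PM) \<le> 16 * (M * B)"
        unfolding eq by (simp add: D_def power2_eq_square)
    qed
    also have "\<dots> \<le> 2 * (16 * (M * B))"
    proof -
      have "card ?T \<le> card {z, (snd z, fst z)}" by (intro card_mono) auto
      also have "\<dots> \<le> 2" by (simp add: card_insert_if)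
      finally have "real (card ?T) * (16 * (M * B)) \<le> 2 * (16 * (M * B))"
        using MB by (intro mult_right_mono) auto
      then show ?thesis by simp
    qed
    finally show ?thesis by simp
  qed
  have "(\<integral>x. (\<Sum>z\<in>Z. D z x)\<^sup>2 \<partial>PM) = (\<integral>x. (\<Sum>z\<in>Z. \<Sum>z'\<in>Z. D z x * D z' x) \<partial>PM)"
    by (simp add: power2_eq_square sum_product)
  also have "\<dots> = (\<Sum>z\<in>Z. \<Sum>z'\<in>Z. \<integral>x. D z x * D z' x \<partial>PM)"
    using int by (simp add: Bochner_Integration.integral_sum Bochner_Integration.integrable_sum)
  also have "\<dots> \<le> (\<Sum>z\<in>Z. 32 * (M * B))" by (intro sum_mono row)
  finally show ?thesis by (simp add: D_def case_prod_unfold mult.commute)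
qed

text \<open>Independent centred summands are orthogonal, and a variance is at most the raw second
  moment.\<close>

lemma sum_centered_second_moment_le:
  fixes \<psi> :: "'a \<Rightarrow> real" and v :: "nat \<Rightarrow> real"
  assumes [measurable]: "\<psi> \<in> borel_measurable borel" and bd: "\<And>x. \<bar>\<psi> x\<bar> \<le> C"
    and V: "\<And>a. (\<integral>x. (\<psi> x)\<^sup>2 \<partial>\<mu> a) \<le> V"
  shows "(\<integral>x. (\<Sum>a\<in>I. v a * (\<psi> (x a) - (\<integral>t. \<psi> t \<partial>\<mu> a)))\<^sup>2 \<partial>PM) \<le> V * (\<Sum>a\<in>I. (v a)\<^sup>2)"
proof -
  define T where "T a s = \<psi> s - (\<integral>t. \<psi> t \<partial>\<mu> a)" for a s
  have [measurable]: "T a \<in> borel_measurable borel" for a unfolding T_def by measurable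
  have int\<psi>: "integrable (\<mu> a) \<psi>" for a using bd by (intro integrable_bounded[of _ C]) auto
  have E\<psi>: "\<bar>\<integral>t. \<psi> t \<partial>\<mu> a\<bar> \<le> C" for a
  proof -
    have "\<psi> x \<le> C" "- C \<le> \<psi> x" for x using bd[of x] by auto
    then show ?thesis
      using M.integral_le_const[OF int\<psi>[of a], of C] M.integral_ge_const[OF int\<psi>[of a], of "-C"]
      by (auto simp: abs_le_iff)
  qed
  have Tb: "\<bar>T a s\<bar> \<le> 2 * C" for a s unfolding T_def using bd[of s] E\<psi>[of a] by linarith
  have C0: "C \<ge> 0" using E\<psi>[of 0] by linarith
  have T0: "(\<integral>s. T a s \<partial>\<mu> a) = 0" for a
  proof -
    show ?thesis unfolding T_def using int\<psi> by (simp add: M.prob_space)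
  qed
  have TV: "(\<integral>s. T a s * T a s \<partial>\<mu> a) \<le> V" for a
  proof -
    have "\<bar>(\<psi> x)\<^sup>2\<bar> \<le> C\<^sup>2" for x using power_mono[OF bd[of x] abs_ge_zero, of 2] by simp
    then have "integrable (\<mu> a) (\<lambda>x. (\<psi> x)\<^sup>2)" by (intro integrable_bounded[of _ "C\<^sup>2"]) auto
    from M.variance_eq[OF int\<psi> this] have "M.variance a \<psi> \<le> V"
      using V[of a] zero_le_power2[of "\<integral>t. \<psi> t \<partial>\<mu> a"] by linarith
    then show ?thesis unfolding T_def by (simp add: power2_eq_square)
  qed
  have int: "integrable PM (\<lambda>x. T a (x a) * T b (x b))" if "a \<in> I" "b \<in> I" for a b
  proof (rule integrable_PM)
    show "\<bar>T a (x a) * T b (x b)\<bar> \<le> 2 * C * (2 * C)" for x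
      unfolding abs_mult using Tb C0 by (intro mult_mono) auto
  qed (use that in measurable)
  have "0 \<le> (\<integral>x. (\<psi> x)\<^sup>2 \<partial>\<mu> 0)" by simp
  with V[of 0] have V0: "V \<ge> 0" by linarith
  have cross: "(\<integral>x. T a (x a) * T b (x b) \<partial>PM) = 0" if "a \<in> I" "b \<in> I" "a \<noteq> b" for a b
    using that int[of a b] T0[of a] by (intro integral_coordinate_zero[of a]) auto
  have diag: "(\<integral>x. T a (x a) * T a (x a) \<partial>PM) \<le> V" if "a \<in> I" for a
    using that int[of a a] TV[of a] V0 by (intro integral_coordinate_le[of a]) auto
  have "(\<integral>x. (\<Sum>a\<in>I. v a * T a (x a))\<^sup>2 \<partial>PM)
      = (\<integral>x. (\<Sum>a\<in>I. \<Sum>b\<in>I. v a * v b * (T a (x a) * T b (x b))) \<partial>PM)"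
    by (simp add: power2_eq_square sum_product mult_ac)
  also have "\<dots> = (\<Sum>a\<in>I. \<Sum>b\<in>I. v a * v b * (\<integral>x. T a (x a) * T b (x b) \<partial>PM))"
    using int by (simp add: Bochner_Integration.integral_sum Bochner_Integration.integrable_sum)
  also have "\<dots> = (\<Sum>a\<in>I. (v a)\<^sup>2 * (\<integral>x. T a (x a) * T a (x a) \<partial>PM))"
  proof (rule sum.cong[OF refl])
    fix a assume a: "a \<in> I"
    have "(\<Sum>b\<in>I. v a * v b * (\<integral>x. T a (x a) * T b (x b) \<partial>PM))
      = (\<Sum>b\<in>{a}. v a * v b * (\<integral>x. T a (x a) * T b (x b) \<partial>PM))"
      using a cross by (intro sum.mono_neutral_right) auto
    then show "(\<Sum>b\<in>I. v a * v b * (\<integral>x. T a (x a) * T b (x b) \<partial>PM))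
      = (v a)\<^sup>2 * (\<integral>x. T a (x a) * T a (x a) \<partial>PM)" by (simp add: power2_eq_square)
  qed
  also have "\<dots> \<le> (\<Sum>a\<in>I. (v a)\<^sup>2 * V)"
    by (intro sum_mono mult_left_mono diag) auto
  finally show ?thesis by (simp add: T_def sum_distrib_left mult.commute)
qed

lemma sum_kernel_power2_mean_le:
  assumes Z: "Z \<subseteq> off_diag I"
  shows "(\<integral>x. (\<Sum>(a, b)\<in>Z. (g (x a) (x b))\<^sup>2) \<partial>PM) \<le> M * B * real (card Z)"
proof -
  have fin: "finite Z" using Z by (rule finite_subset) simp
  have int: "integrable PM (\<lambda>x. (g (x (fst z)) (x (snd z)))\<^sup>2)" if "z \<in> Z" for z
  proof (rule integrable_PM)
    show "\<bar>(g (x (fst z)) (x (snd z)))\<^sup>2\<bar> \<le> B\<^sup>2" for x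
      using g_nonneg g_le by (simp add: power_mono)
  qed (use that Z in \<open>auto simp: off_diag_def intro!: borel_measurable_power g_measurable2 coord_measurable\<close>)
  have one: "(\<integral>x. (g (x (fst z)) (x (snd z)))\<^sup>2 \<partial>PM) \<le> M * B" if "z \<in> Z" for z
  proof (rule integral_coordinate_le[of "fst z"])
    have z: "fst z \<in> I" "snd z \<in> I" "fst z \<noteq> snd z" using that Z by (auto simp: off_diag_def)
    then show "fst z \<in> I" by simp
    fix x
    have "(\<integral>y. (g y (x (snd z)))\<^sup>2 \<partial>\<mu> (fst z)) \<le> (\<integral>y. B * g y (x (snd z)) \<partial>\<mu> (fst z))"
    proof (rule integral_mono')
      show "integrable (\<mu> (fst z)) (\<lambda>y. B * g y (x (snd z)))"
        using g_nonneg g_le by (auto intro!: integrable_bounded[of _ B])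
      show "(g y (x (snd z)))\<^sup>2 \<le> B * g y (x (snd z))" for y
        unfolding power2_eq_square using g_nonneg g_le by (intro mult_right_mono) auto
      show "0 \<le> B * g y (x (snd z))" for y using g_nonneg B_nonneg by simp
    qed
    also have "\<dots> = B * proj (fst z) (x (snd z))"
      using g_sym by (simp add: proj_def cong: Bochner_Integration.integral_cong)
    also have "\<dots> \<le> B * M" using proj_bounds B_nonneg by (intro mult_left_mono) auto
    finally show "(\<integral>y. (g ((x(fst z := y)) (fst z)) ((x(fst z := y)) (snd z)))\<^sup>2 \<partial>\<mu> (fst z)) \<le> M * B"
      using z by (simp add: mult.commute)
  qed (use int that M_nonneg B_nonneg in auto)
  have "(\<integral>x. (\<Sum>z\<in>Z. (g (x (fst z)) (x (snd z)))\<^sup>2) \<partial>PM) = (\<Sum>z\<in>Z. \<integral>x. (g (x (fst z)) (x (snd z)))\<^sup>2 \<partial>PM)"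
    using int by (rule Bochner_Integration.integral_sum)
  also have "\<dots> \<le> (\<Sum>z\<in>Z. M * B)" by (intro sum_mono one)
  finally show ?thesis by (simp add: case_prod_unfold mult.commute)
qed

end

section \<open>Two samples\<close>

lemma sum_off_diag_fst:
  assumes "finite I"
  shows "(\<Sum>(a, b)\<in>off_diag I. f a) = (real (card I) - 1) * (\<Sum>a\<in>I. f a)"
proof -
  have "off_diag I = Sigma I (\<lambda>a. I - {a})" by (auto simp: off_diag_def)
  then have "(\<Sum>(a, b)\<in>off_diag I. f a) = (\<Sum>(a, b)\<in>Sigma I (\<lambda>a. I - {a}). f a)"
    by (rule arg_cong)
  also have "\<dots> = (\<Sum>a\<in>I. \<Sum>b\<in>I - {a}. f a)"
    using assms by (intro sum.Sigma[symmetric]) auto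
  also have "\<dots> = (\<Sum>a\<in>I. (real (card I) - 1) * f a)"
  proof (rule sum.cong[OF refl])
    fix a assume "a \<in> I"
    then have "card I > 0" using assms card_gt_0_iff by blast
    then show "(\<Sum>b\<in>I - {a}. f a) = (real (card I) - 1) * f a"
      using \<open>a \<in> I\<close> by (simp add: of_nat_diff)
  qed
  finally show ?thesis by (simp add: sum_distrib_left)
qed

lemma sum_off_diag_snd:
  assumes "finite I"
  shows "(\<Sum>(a, b)\<in>off_diag I. f b) = (real (card I) - 1) * (\<Sum>a\<in>I. f a)"
proof -
  have "(\<Sum>(a, b)\<in>off_diag I. f b) = (\<Sum>(a, b)\<in>off_diag I. f a)"
    by (rule sum.reindex_bij_witness[of _ prod.swap prod.swap]) (auto simp: off_diag_def)
  then show ?thesis using sum_off_diag_fst[OF assms] by simp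
qed

text \<open>The familiar form of the unbiased estimator of the squared maximum mean discrepancy. The
  two mixed terms of \<open>h_gram\<close> give the same cross sum, each with the factor (n1 - 1)(n2
  - 1) from the free indices.\<close>

lemma U_gram_expand:
  assumes "2 \<le> n1" "2 \<le> n2"
  shows "U_gram n1 n2 k = (\<Sum>(a, b)\<in>off_diag {1..n1}. k a b) / (real n1 * (real n1 - 1))
    + (\<Sum>(c, d)\<in>off_diag {n1+1..n1+n2}. k c d) / (real n2 * (real n2 - 1))
    - 2 / (real n1 * real n2) * (\<Sum>a\<in>{1..n1}. \<Sum>d\<in>{n1+1..n1+n2}. k a d)"
proof -
  let ?I = "{1..n1}" and ?J = "{n1+1..n1+n2}"
  let ?X = "\<Sum>(a, b)\<in>off_diag ?I. k a b" and ?Y = "\<Sum>(c, d)\<in>off_diag ?J. k c d"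
    and ?Z = "\<Sum>a\<in>?I. \<Sum>d\<in>?J. k a d"
  have cI: "real (card (off_diag ?I)) = real n1 * (real n1 - 1)" "real (card ?I) = real n1"
    and cJ: "real (card (off_diag ?J)) = real n2 * (real n2 - 1)" "real (card ?J) = real n2"
    using assms by (simp_all add: card_off_diag of_nat_diff)
  have ad: "(\<Sum>(a, b)\<in>off_diag ?I. \<Sum>(c, d)\<in>off_diag ?J. k a d) = (real n1 - 1) * ((real n2 - 1) * ?Z)"
    using sum_off_diag_snd[of ?J] sum_off_diag_fst[of ?I "\<lambda>a. (real n2 - 1) * (\<Sum>d\<in>?J. k a d)"]
    by (simp add: cI cJ sum_distrib_left)
  have bc: "(\<Sum>(a, b)\<in>off_diag ?I. \<Sum>(c, d)\<in>off_diag ?J. k b c) = (real n1 - 1) * ((real n2 - 1) * ?Z)"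
    using sum_off_diag_fst[of ?J] sum_off_diag_snd[of ?I "\<lambda>a. (real n2 - 1) * (\<Sum>d\<in>?J. k a d)"]
    by (simp add: cI cJ sum_distrib_left)
  have "(\<Sum>(a, b)\<in>off_diag ?I. \<Sum>(c, d)\<in>off_diag ?J. h_gram k a b c d)
     = (\<Sum>(a, b)\<in>off_diag ?I. \<Sum>(c, d)\<in>off_diag ?J. k a b)
     + (\<Sum>(a, b)\<in>off_diag ?I. \<Sum>(c, d)\<in>off_diag ?J. k c d)
     - (\<Sum>(a, b)\<in>off_diag ?I. \<Sum>(c, d)\<in>off_diag ?J. k a d)
     - (\<Sum>(a, b)\<in>off_diag ?I. \<Sum>(c, d)\<in>off_diag ?J. k b c)"
    by (simp only: h_gram_def case_prod_unfold sum_subtractf sum.distrib)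
  also have "(\<Sum>(a, b)\<in>off_diag ?I. \<Sum>(c, d)\<in>off_diag ?J. k a b) = real n2 * (real n2 - 1) * ?X"
    by (simp only: case_prod_unfold sum_constant cJ sum_distrib_left)
  also have "(\<Sum>(a, b)\<in>off_diag ?I. \<Sum>(c, d)\<in>off_diag ?J. k c d) = real n1 * (real n1 - 1) * ?Y"
    by (simp only: case_prod_unfold sum_constant cI)
  finally have "(\<Sum>(a, b)\<in>off_diag ?I. \<Sum>(c, d)\<in>off_diag ?J. h_gram k a b c d)
    = real n2 * (real n2 - 1) * ?X + real n1 * (real n1 - 1) * ?Y - 2 * ((real n1 - 1) * ((real n2 - 1) * ?Z))"
    unfolding ad bc by simp
  moreover have "real n1 > 0" "real n1 - 1 > 0" "real n2 > 0" "real n2 - 1 > 0" using assms by auto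
  moreover have "(m * m' * X + n * n' * Y - 2 * (n' * (m' * Z))) / (n * n' * m * m')
      = X / (n * n') + Y / (m * m') - 2 / (n * m) * Z"
    if "n > 0" "n' > 0" "m > 0" "m' > 0" for n n' m m' X Y Z :: real
    using that by (simp add: field_simps)
  ultimately show ?thesis
    unfolding U_gram_def by (simp only:)
qed

locale two_sample = kernel_sample "\<lambda>i. if i \<le> n1 then P else Q" "{1..n1+n2}" g B M
  for P Q :: "'a :: topological_space measure" and n1 n2 :: nat and g B M +
  assumes n1: "2 \<le> n1" and n2: "2 \<le> n2"
begin

text \<open>The difference of the kernel mean embeddings of the two laws. Its difference of means
  \<theta> is the squared maximum mean discrepancy, the target of \<open>U\<close>.\<close>

definition \<psi> :: "'a \<Rightarrow> real" where
  "\<psi> t = (\<integral>y. g t y \<partial>P) - (\<integral>y. g t y \<partial>Q)"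

definition \<theta> :: real where
  "\<theta> = (\<integral>t. \<psi> t \<partial>P) - (\<integral>t. \<psi> t \<partial>Q)"

definition r :: real where "r = 1 / real n1 + 1 / real n2"

definition U :: "(nat \<Rightarrow> 'a) \<Rightarrow> real" where
  "U x = U_gram n1 n2 (\<lambda>a b. g (x a) (x b))"

definition D :: "(nat \<Rightarrow> 'a) \<Rightarrow> real" where
  "D x = U_gram n1 n2 (\<lambda>a b. degen a b (x a) (x b))"

definition wt :: "nat \<Rightarrow> real" where
  "wt a = (if a \<le> n1 then 2 / real n1 else - (2 / real n2))"

definition Lin :: "(nat \<Rightarrow> 'a) \<Rightarrow> real" where
  "Lin x = (\<Sum>a\<in>{1..n1+n2}. wt a * (\<psi> (x a) - (\<integral>t. \<psi> t \<partial>(if a \<le> n1 then P else Q))))"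

lemma r_pos: "r > 0" using n1 n2 by (simp add: r_def add_pos_pos)

lemma proj_cases: "proj b t = (if b \<le> n1 then (\<integral>y. g t y \<partial>P) else (\<integral>y. g t y \<partial>Q))"
  by (simp add: proj_def)

lemma \<psi>_eq: "\<psi> t = proj 1 t - proj (n1 + 1) t"
  using n1 by (simp add: \<psi>_def proj_cases)

lemma \<psi>_measurable [measurable]: "\<psi> \<in> borel_measurable borel"
  unfolding \<psi>_eq[abs_def] by measurable

lemma \<psi>_bound: "\<bar>\<psi> t\<bar> \<le> B"
  unfolding \<psi>_eq using proj_bounds[of 1 t] proj_bounds[of "n1 + 1" t] by linarith

lemma mean_cases: "mean a b = mean (if a \<le> n1 then 1 else n1 + 1) (if b \<le> n1 then 1 else n1 + 1)"
  using n1 by (auto simp: mean_def proj_def)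

lemma integral_\<psi>: "(\<integral>t. \<psi> t \<partial>P) = mean 1 1 - mean 1 (n1 + 1)"
  "(\<integral>t. \<psi> t \<partial>Q) = mean 1 (n1 + 1) - mean (n1 + 1) (n1 + 1)"
proof -
  have i: "integrable (if a \<le> n1 then P else Q) (proj b)" for a b
    using proj_bounds by (intro integrable_bounded[of _ B]) auto
  show "(\<integral>t. \<psi> t \<partial>P) = mean 1 1 - mean 1 (n1 + 1)"
    using n1 i[of 1] by (simp add: \<psi>_eq[abs_def] mean_def)
  have "(\<integral>t. \<psi> t \<partial>Q) = mean (n1 + 1) 1 - mean (n1 + 1) (n1 + 1)"
    using n1 i[of "n1 + 1"] by (simp add: \<psi>_eq[abs_def] mean_def)
  then show "(\<integral>t. \<psi> t \<partial>Q) = mean 1 (n1 + 1) - mean (n1 + 1) (n1 + 1)"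
    by (simp add: mean_sym)
qed

text \<open>Hoeffding decomposition.\<close>

lemma U_decomposition: "U x = D x + Lin x + \<theta>"
proof -
  let ?I = "{1..n1}" and ?J = "{n1+1..n1+n2}"
  define m11 where "m11 = mean 1 1"
  define m12 where "m12 = mean 1 (n1 + 1)"
  define m22 where "m22 = mean (n1 + 1) (n1 + 1)"
  note I\<psi> = integral_\<psi>[folded m11_def m12_def m22_def]
  define p where "p t = proj 1 t" for t
  define q where "q t = proj (n1 + 1) t" for t
  define dg where "dg a b = degen a b (x a) (x b)" for a b
  define Sp where "Sp K = (\<Sum>a\<in>K. p (x a))" for K
  define Sq where "Sq K = (\<Sum>a\<in>K. q (x a))" for K
  have \<psi>pq: "\<psi> t = p t - q t" for t by (simp add: \<psi>_eq p_def q_def)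
  have n: "real n1 > 0" "real n1 - 1 > 0" "real n2 > 0" "real n2 - 1 > 0" using n1 n2 by auto
  have cI: "real (card (off_diag ?I)) = real n1 * (real n1 - 1)" "real (card ?I) = real n1"
    and cJ: "real (card (off_diag ?J)) = real n2 * (real n2 - 1)" "real (card ?J) = real n2"
    using n1 n2 by (simp_all add: card_off_diag of_nat_diff)
  have pq: "proj a = (if a \<le> n1 then p else q)" for a
    using n1 by (auto simp: fun_eq_iff p_def q_def proj_cases)
  have mm: "mean a b = m11" if "a \<le> n1" "b \<le> n1" for a b
    using mean_cases[of a b] that by (simp add: m11_def m12_def m22_def)
  have mm2: "mean a b = m12" if "a \<le> n1" "n1 < b" for a b
    using mean_cases[of a b] that by (simp add: m11_def m12_def m22_def)
  have mm3: "mean a b = m22" if "n1 < a" "n1 < b" for a b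
    using mean_cases[of a b] that by (simp add: m11_def m12_def m22_def)
  have g: "g (x a) (x b) = dg a b + proj b (x a) + proj a (x b) - mean a b" for a b
    by (simp add: dg_def degen_def)
  have "(\<Sum>(a, b)\<in>off_diag ?I. g (x a) (x b))
      = (\<Sum>(a, b)\<in>off_diag ?I. dg a b + p (x a) + p (x b) - m11)"
    unfolding g by (intro sum.cong refl) (auto simp: off_diag_def pq mm mm3)
  also have "\<dots> = (\<Sum>(a, b)\<in>off_diag ?I. dg a b) + (\<Sum>(a, b)\<in>off_diag ?I. p (x a))
      + (\<Sum>(a, b)\<in>off_diag ?I. p (x b)) - real n1 * (real n1 - 1) * m11"
    by (simp only: case_prod_unfold sum_subtractf sum.distrib sum_constant cI)
  also have "\<dots> = (\<Sum>(a, b)\<in>off_diag ?I. dg a b) + 2 * ((real n1 - 1) * Sp ?I) - real n1 * (real n1 - 1) * m11"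
    using sum_off_diag_fst[of ?I "\<lambda>a. p (x a)"] sum_off_diag_snd[of ?I "\<lambda>a. p (x a)"]
    unfolding cI Sp_def by simp
  finally have XI: "(\<Sum>(a, b)\<in>off_diag ?I. g (x a) (x b))
      = (\<Sum>(a, b)\<in>off_diag ?I. dg a b) + 2 * ((real n1 - 1) * Sp ?I) - real n1 * (real n1 - 1) * m11" .
  have "(\<Sum>(a, b)\<in>off_diag ?J. g (x a) (x b))
      = (\<Sum>(a, b)\<in>off_diag ?J. dg a b + q (x a) + q (x b) - m22)"
    unfolding g by (intro sum.cong refl) (auto simp: off_diag_def pq mm mm3)
  also have "\<dots> = (\<Sum>(a, b)\<in>off_diag ?J. dg a b) + (\<Sum>(a, b)\<in>off_diag ?J. q (x a))
      + (\<Sum>(a, b)\<in>off_diag ?J. q (x b)) - real n2 * (real n2 - 1) * m22"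
    by (simp only: case_prod_unfold sum_subtractf sum.distrib sum_constant cJ)
  also have "\<dots> = (\<Sum>(a, b)\<in>off_diag ?J. dg a b) + 2 * ((real n2 - 1) * Sq ?J) - real n2 * (real n2 - 1) * m22"
    using sum_off_diag_fst[of ?J "\<lambda>a. q (x a)"] sum_off_diag_snd[of ?J "\<lambda>a. q (x a)"]
    unfolding cJ Sq_def by simp
  finally have XJ: "(\<Sum>(a, b)\<in>off_diag ?J. g (x a) (x b))
      = (\<Sum>(a, b)\<in>off_diag ?J. dg a b) + 2 * ((real n2 - 1) * Sq ?J) - real n2 * (real n2 - 1) * m22" .
  have "(\<Sum>a\<in>?I. \<Sum>b\<in>?J. g (x a) (x b)) = (\<Sum>a\<in>?I. \<Sum>b\<in>?J. dg a b + q (x a) + p (x b) - m12)"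
    unfolding g by (intro sum.cong refl) (auto simp: pq mm2)
  also have "\<dots> = (\<Sum>a\<in>?I. \<Sum>b\<in>?J. dg a b) + real n2 * Sq ?I + real n1 * Sp ?J - real n1 * (real n2 * m12)"
    by (simp only: sum_subtractf sum.distrib sum_constant cI cJ Sp_def Sq_def sum_distrib_left)
  finally have XIJ: "(\<Sum>a\<in>?I. \<Sum>b\<in>?J. g (x a) (x b))
    = (\<Sum>a\<in>?I. \<Sum>b\<in>?J. dg a b) + real n2 * Sq ?I + real n1 * Sp ?J - real n1 * (real n2 * m12)" .
  have lin: "(\<Sum>a\<in>K. c * (p (x a) - q (x a) - e)) = c * (Sp K - Sq K - real (card K) * e)" for K c e
    by (simp only: Sp_def Sq_def sum_distrib_left[symmetric] sum_subtractf sum_constant)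
  \<comment> \<open>The bracket with the three means is \<theta>. It enters here with factor -1 and
    through the centring of \<open>Lin\<close> with factor -2, so \<open>+ \<theta>\<close>
    remains.\<close>
  have "U x - D x = 2 / real n1 * (Sp ?I - Sq ?I) - 2 / real n2 * (Sp ?J - Sq ?J) - (m11 + m22 - 2 * m12)"
    unfolding U_def D_def U_gram_expand[OF n1 n2] XI XJ XIJ dg_def[symmetric]
    using n by (simp add: divide_simps) (simp add: algebra_simps)
  moreover have "Lin x = 2 / real n1 * (Sp ?I - Sq ?I) - 2 / real n2 * (Sp ?J - Sq ?J) - 2 * (m11 + m22 - 2 * m12)"
  proof -
    have "{1..n1+n2} = ?I \<union> ?J" by auto
    then have "Lin x = (\<Sum>a\<in>?I. wt a * (\<psi> (x a) - (\<integral>t. \<psi> t \<partial>(if a \<le> n1 then P else Q))))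
       + (\<Sum>a\<in>?J. wt a * (\<psi> (x a) - (\<integral>t. \<psi> t \<partial>(if a \<le> n1 then P else Q))))"
      unfolding Lin_def by (simp only:) (rule sum.union_disjoint; auto)
    also have "(\<Sum>a\<in>?I. wt a * (\<psi> (x a) - (\<integral>t. \<psi> t \<partial>(if a \<le> n1 then P else Q))))
      = (\<Sum>a\<in>?I. 2 / real n1 * (p (x a) - q (x a) - (m11 - m12)))"
      by (intro sum.cong refl) (simp add: wt_def I\<psi>, simp add: \<psi>pq)
    also have "(\<Sum>a\<in>?J. wt a * (\<psi> (x a) - (\<integral>t. \<psi> t \<partial>(if a \<le> n1 then P else Q))))
      = (\<Sum>a\<in>?J. - (2 / real n2) * (p (x a) - q (x a) - (m12 - m22)))"
      by (intro sum.cong refl) (simp add: wt_def I\<psi>, simp add: \<psi>pq)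
    finally have "Lin x = 2 / real n1 * (Sp ?I - Sq ?I - real n1 * (m11 - m12))
       + - (2 / real n2) * (Sp ?J - Sq ?J - real n2 * (m12 - m22))"
      unfolding lin cI cJ .
    then show ?thesis using n by (simp add: right_diff_distrib)
  qed
  ultimately show ?thesis unfolding \<theta>_def I\<psi> by simp
qed

text \<open>The two within-sample sums and the cross sum are bounded separately, at the cost of a
  factor 3. Since 1 / (n (n - 1)) is at most 2 / n^2 for n \<ge> 2, the three rates add up to the
  perfect square \<open>2 * r\<^sup>2\<close>.\<close>

lemma D_second_moment: "(\<integral>x. (D x)\<^sup>2 \<partial>PM) \<le> 192 * (M * B) * r\<^sup>2"
proof -
  let ?I = "{1..n1}" and ?J = "{n1+1..n1+n2}"
  let ?a = "real n1 * (real n1 - 1)" and ?b = "real n2 * (real n2 - 1)" and ?c = "real n1 * real n2"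
  define S where "S Z x = (\<Sum>(a, b)\<in>Z. degen a b (x a) (x b))" for Z x
  have n: "real n1 > 0" "real n1 - 1 > 0" "real n2 > 0" "real n2 - 1 > 0" using n1 n2 by auto
  have sub: "off_diag ?I \<subseteq> off_diag {1..n1+n2}" "off_diag ?J \<subseteq> off_diag {1..n1+n2}"
    "?I \<times> ?J \<subseteq> off_diag {1..n1+n2}" by (auto simp: off_diag_def)
  have D: "D x = S (off_diag ?I) x / ?a + S (off_diag ?J) x / ?b - 2 / ?c * S (?I \<times> ?J) x" for x
    unfolding D_def U_gram_expand[OF n1 n2] S_def by (simp add: sum.cartesian_product)
  have int: "integrable PM (\<lambda>x. (S Z x)\<^sup>2)" if Z: "Z \<subseteq> off_diag {1..n1+n2}" for Z
  proof (rule integrable_PM)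
    show "(\<lambda>x. (S Z x)\<^sup>2) \<in> borel_measurable PM"
      unfolding S_def case_prod_unfold using Z
      by (intro borel_measurable_power borel_measurable_sum degen_measurable coord_measurable)
         (auto simp: off_diag_def)
    have "\<bar>S Z x\<bar> \<le> (\<Sum>z\<in>Z. 2 * B)" for x
      unfolding S_def case_prod_unfold by (rule order_trans[OF sum_abs sum_mono]) (rule degen_bound)
    from power_mono[OF this abs_ge_zero, where n = 2] show "\<bar>(S Z x)\<^sup>2\<bar> \<le> (\<Sum>z\<in>Z. 2 * B)\<^sup>2" for x by simp
  qed
  have MB: "0 \<le> M * B" using M_nonneg B_nonneg by simp
  have three: "(u + v - w)\<^sup>2 \<le> 3 * (u\<^sup>2 + v\<^sup>2 + w\<^sup>2)" for u v w :: real
  proof -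
    have "0 \<le> (u - v)\<^sup>2 + (u + w)\<^sup>2 + (v + w)\<^sup>2" by simp
    then show ?thesis by (simp add: power2_eq_square algebra_simps)
  qed
  have cards: "real (card (off_diag ?I)) = ?a" "real (card (off_diag ?J)) = ?b" "real (card (?I \<times> ?J)) = ?c"
    using n1 n2 by (simp_all add: card_off_diag of_nat_diff card_cartesian_product)
  have mom: "(\<integral>x. (S (off_diag ?I) x)\<^sup>2 \<partial>PM) \<le> 32 * (M * B) * ?a"
    "(\<integral>x. (S (off_diag ?J) x)\<^sup>2 \<partial>PM) \<le> 32 * (M * B) * ?b"
    "(\<integral>x. (S (?I \<times> ?J) x)\<^sup>2 \<partial>PM) \<le> 32 * (M * B) * ?c"
    unfolding S_def cards[symmetric] by (intro sum_degen_second_moment_le sub)+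
  have "(\<integral>x. (D x)\<^sup>2 \<partial>PM) \<le> (\<integral>x. 3 * ((S (off_diag ?I) x)\<^sup>2 / ?a\<^sup>2 + (S (off_diag ?J) x)\<^sup>2 / ?b\<^sup>2
      + 4 / ?c\<^sup>2 * (S (?I \<times> ?J) x)\<^sup>2) \<partial>PM)"
  proof (rule integral_mono')
    show "integrable PM (\<lambda>x. 3 * ((S (off_diag ?I) x)\<^sup>2 / ?a\<^sup>2 + (S (off_diag ?J) x)\<^sup>2 / ?b\<^sup>2
      + 4 / ?c\<^sup>2 * (S (?I \<times> ?J) x)\<^sup>2))"
      using int[OF sub(1)] int[OF sub(2)] int[OF sub(3)] by simp
    show "(D x)\<^sup>2 \<le> 3 * ((S (off_diag ?I) x)\<^sup>2 / ?a\<^sup>2 + (S (off_diag ?J) x)\<^sup>2 / ?b\<^sup>2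
      + 4 / ?c\<^sup>2 * (S (?I \<times> ?J) x)\<^sup>2)" for x
      unfolding D using three[of "S (off_diag ?I) x / ?a" "S (off_diag ?J) x / ?b" "2 / ?c * S (?I \<times> ?J) x"]
      by (simp add: power_divide power_mult_distrib)
  qed auto
  also have "\<dots> = 3 * ((\<integral>x. (S (off_diag ?I) x)\<^sup>2 \<partial>PM) / ?a\<^sup>2 + (\<integral>x. (S (off_diag ?J) x)\<^sup>2 \<partial>PM) / ?b\<^sup>2
      + 4 / ?c\<^sup>2 * (\<integral>x. (S (?I \<times> ?J) x)\<^sup>2 \<partial>PM))"
    using int[OF sub(1)] int[OF sub(2)] int[OF sub(3)] by simp
  also have "\<dots> \<le> 3 * ((32 * (M * B) * ?a) / ?a\<^sup>2 + (32 * (M * B) * ?b) / ?b\<^sup>2 + 4 / ?c\<^sup>2 * (32 * (M * B) * ?c))"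
    using mom by (intro mult_left_mono add_mono divide_right_mono) auto
  also have "\<dots> = 96 * (M * B) * (1 / ?a + 1 / ?b + 4 / ?c)"
  proof -
    have "?a / ?a\<^sup>2 = 1 / ?a" "?b / ?b\<^sup>2 = 1 / ?b" "?c / ?c\<^sup>2 = 1 / ?c"
      using n by (simp_all add: power2_eq_square)
    then have "32 * (M * B) * ?a / ?a\<^sup>2 = 32 * (M * B) * (1 / ?a)" "32 * (M * B) * ?b / ?b\<^sup>2 = 32 * (M * B) * (1 / ?b)"
      "4 / ?c\<^sup>2 * (32 * (M * B) * ?c) = 32 * (M * B) * (4 * (1 / ?c))"
      by (metis times_divide_eq_right, metis times_divide_eq_right, simp add: field_simps power2_eq_square)
    then show ?thesis by (simp add: algebra_simps)
  qed
  also have "\<dots> \<le> 96 * (M * B) * (2 * r\<^sup>2)"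
  proof (rule mult_left_mono)
    have inv: "1 / (u * (u - 1)) \<le> 2 * (1 / u)\<^sup>2" if "u \<ge> 2" for u :: real
      using that by (simp add: divide_simps power2_eq_square)
    show "1 / ?a + 1 / ?b + 4 / ?c \<le> 2 * r\<^sup>2"
      using inv[of "real n1"] inv[of "real n2"] n1 n2 by (simp add: r_def power2_sum algebra_simps)
  qed (use MB in simp)
  finally show ?thesis by simp
qed

lemma Lin_second_moment:
  assumes "(\<integral>x. (\<psi> x)\<^sup>2 \<partial>P) \<le> V" "(\<integral>x. (\<psi> x)\<^sup>2 \<partial>Q) \<le> V"
  shows "(\<integral>x. (Lin x)\<^sup>2 \<partial>PM) \<le> 4 * r * V"
proof -
  have "(\<integral>x. (Lin x)\<^sup>2 \<partial>PM) \<le> V * (\<Sum>a\<in>{1..n1+n2}. (wt a)\<^sup>2)"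
    unfolding Lin_def using assms by (intro sum_centered_second_moment_le[OF \<psi>_measurable \<psi>_bound]) auto
  also have "(\<Sum>a\<in>{1..n1+n2}. (wt a)\<^sup>2) = 4 * r"
  proof -
    have "{1..n1+n2} = {1..n1} \<union> {n1+1..n1+n2}" by auto
    then have "(\<Sum>a\<in>{1..n1+n2}. (wt a)\<^sup>2) = (\<Sum>a\<in>{1..n1}. (wt a)\<^sup>2) + (\<Sum>a\<in>{n1+1..n1+n2}. (wt a)\<^sup>2)"
      by (simp only:) (rule sum.union_disjoint; auto)
    also have "\<dots> = (\<Sum>a\<in>{1..n1}. (2 / real n1)\<^sup>2) + (\<Sum>a\<in>{n1+1..n1+n2}. (2 / real n2)\<^sup>2)"
      by (intro arg_cong2[of _ _ _ _ "(+)"] sum.cong) (auto simp: wt_def)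
    finally show ?thesis using n1 n2 by (simp add: r_def power2_eq_square field_simps)
  qed
  finally show ?thesis by (simp add: mult.commute)
qed

text \<open>If \<open>D\<close>, \<open>Lin\<close> and the squared kernel sum stay below the levels
  \<open>t1\<close>, \<open>t2\<close> and \<gamma>, the decomposition forces \<open>U\<close> above
  the acceptance bound. Markov's inequality is applied to each of the three exceptions.\<close>

lemma prob_U_le:
  assumes V: "(\<integral>x. (\<psi> x)\<^sup>2 \<partial>P) \<le> V" "(\<integral>x. (\<psi> x)\<^sup>2 \<partial>Q) \<le> V"
    and pos: "t1 > 0" "t2 > 0" "\<gamma> > 0" "c \<ge> 0"
    and \<theta>: "\<theta> \<ge> t1 + t2 + c * sqrt \<gamma>"
    and E: "E \<subseteq> {x \<in> space PM. U x \<le> c * sqrt (\<Sum>(a, b)\<in>off_diag {1..n1+n2}. (g (x a) (x b))\<^sup>2)}"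
  shows "measure PM E
    \<le> 192 * (M * B) * r\<^sup>2 / t1\<^sup>2 + 4 * r * V / t2\<^sup>2 + M * B * (real (n1 + n2))\<^sup>2 / \<gamma>"
proof -
  define G where "G x = (\<Sum>(a, b)\<in>off_diag {1..n1+n2}. (g (x a) (x b))\<^sup>2)" for x
  have [measurable]: "D \<in> borel_measurable PM"
    unfolding D_def[abs_def] U_gram_expand[OF n1 n2] case_prod_unfold
    by (intro borel_measurable_diff borel_measurable_add borel_measurable_times borel_measurable_divide borel_measurable_const
         borel_measurable_sum degen_measurable coord_measurable) (auto simp: off_diag_def)
  have [measurable]: "Lin \<in> borel_measurable PM"
    unfolding Lin_def[abs_def]
    by (intro borel_measurable_sum borel_measurable_times borel_measurable_diff borel_measurable_const
         measurable_compose[OF coord_measurable \<psi>_measurable]) auto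
  have [measurable]: "G \<in> borel_measurable PM"
    unfolding G_def[abs_def] case_prod_unfold
    by (intro borel_measurable_sum borel_measurable_power g_measurable2 coord_measurable) (auto simp: off_diag_def)
  have G0: "G x \<ge> 0" for x unfolding G_def by (intro sum_nonneg) auto
  have intD: "integrable PM (\<lambda>x. (D x)\<^sup>2)"
  proof (rule integrable_PM)
    fix x
    let ?d = "\<lambda>a b. degen a b (x a) (x b)"
    have "\<bar>D x\<bar> \<le> (\<Sum>z\<in>off_diag {1..n1}. 2 * B) / (real n1 * (real n1 - 1))
      + (\<Sum>z\<in>off_diag {n1+1..n1+n2}. 2 * B) / (real n2 * (real n2 - 1))
      + 2 / (real n1 * real n2) * (\<Sum>a\<in>{1..n1}. \<Sum>d\<in>{n1+1..n1+n2}. 2 * B)" (is "_ \<le> ?K")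
    proof -
      have "\<bar>\<Sum>(a, b)\<in>Z. ?d a b\<bar> \<le> (\<Sum>z\<in>Z. 2 * B)" for Z
        unfolding case_prod_unfold by (rule order_trans[OF sum_abs sum_mono]) (rule degen_bound)
      note pairs = this
      have rect: "\<bar>\<Sum>a\<in>{1..n1}. \<Sum>b\<in>{n1+1..n1+n2}. ?d a b\<bar> \<le> (\<Sum>a\<in>{1..n1}. \<Sum>b\<in>{n1+1..n1+n2}. 2 * B)"
        by (rule order_trans[OF sum_abs sum_mono], rule order_trans[OF sum_abs sum_mono]) (rule degen_bound)
      have comb: "\<bar>u / a + v / b - e * w\<bar> \<le> u' / a + v' / b + e * w'"
        if "\<bar>u\<bar> \<le> u'" "\<bar>v\<bar> \<le> v'" "\<bar>w\<bar> \<le> w'" "0 \<le> a" "0 \<le> b" "0 \<le> e" for u v w u' v' w' a b e :: real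
      proof -
        have "\<bar>u / a\<bar> \<le> u' / a" "\<bar>v / b\<bar> \<le> v' / b" "\<bar>e * w\<bar> \<le> e * w'"
          using that by (auto simp: abs_mult intro: divide_right_mono mult_left_mono)
        then show ?thesis by linarith
      qed
      show ?thesis
        unfolding D_def U_gram_expand[OF n1 n2] by (rule comb[OF pairs pairs rect]) (use n1 n2 in auto)
    qed
    from power_mono[OF this abs_ge_zero, where n = 2] show "\<bar>(D x)\<^sup>2\<bar> \<le> ?K\<^sup>2" by simp
  qed measurable
  have intL: "integrable PM (\<lambda>x. (Lin x)\<^sup>2)"
  proof (rule integrable_PM)
    fix x
    have "\<bar>Lin x\<bar> \<le> (\<Sum>a\<in>{1..n1+n2}. \<bar>wt a\<bar> * (2 * B))"
      unfolding Lin_def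
    proof (rule order_trans[OF sum_abs sum_mono])
      fix a
      have E: "integrable (if a \<le> n1 then P else Q) \<psi>"
        using \<psi>_bound by (intro integrable_bounded[of _ B]) auto
      have "\<psi> x \<le> B" "- B \<le> \<psi> x" for x using \<psi>_bound[of x] by auto
      then have "\<bar>\<integral>t. \<psi> t \<partial>(if a \<le> n1 then P else Q)\<bar> \<le> B"
        using M.integral_le_const[OF E, of B] M.integral_ge_const[OF E, of "-B"]
        by (simp only: abs_le_iff AE_I2 minus_le_iff)
      then have "\<bar>\<psi> (x a) - (\<integral>t. \<psi> t \<partial>(if a \<le> n1 then P else Q))\<bar> \<le> 2 * B"
        using \<psi>_bound[of "x a"] by linarith
      then show "\<bar>wt a * (\<psi> (x a) - (\<integral>t. \<psi> t \<partial>(if a \<le> n1 then P else Q)))\<bar> \<le> \<bar>wt a\<bar> * (2 * B)"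
        unfolding abs_mult by (intro mult_left_mono) auto
    qed
    from power_mono[OF this abs_ge_zero, where n = 2]
    show "\<bar>(Lin x)\<^sup>2\<bar> \<le> (\<Sum>a\<in>{1..n1+n2}. \<bar>wt a\<bar> * (2 * B))\<^sup>2" by simp
  qed measurable
  have intG: "integrable PM G"
  proof (rule integrable_PM)
    show "\<bar>G x\<bar> \<le> (\<Sum>z\<in>off_diag {1..n1+n2}. B\<^sup>2)" for x
      unfolding G_def case_prod_unfold using g_nonneg g_le
      by (intro order_trans[OF sum_abs sum_mono]) (simp add: power_mono)
  qed measurable
  have mD: "measure PM {x \<in> space PM. (D x)\<^sup>2 \<ge> t1\<^sup>2} \<le> 192 * (M * B) * r\<^sup>2 / t1\<^sup>2"
    using integral_Markov_inequality_measure[OF intD, of "{}" "t1\<^sup>2"] pos D_second_moment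
    by (fastforce intro: order_trans divide_right_mono)
  have mL: "measure PM {x \<in> space PM. (Lin x)\<^sup>2 \<ge> t2\<^sup>2} \<le> 4 * r * V / t2\<^sup>2"
    using integral_Markov_inequality_measure[OF intL, of "{}" "t2\<^sup>2"] pos Lin_second_moment[OF V]
    by (fastforce intro: order_trans divide_right_mono)
  have "(\<integral>x. G x \<partial>PM) \<le> M * B * (real (n1 + n2))\<^sup>2"
  proof -
    have "(\<integral>x. G x \<partial>PM) \<le> M * B * real (card (off_diag {1..n1+n2}))"
      unfolding G_def by (rule sum_kernel_power2_mean_le) simp
    also have "\<dots> \<le> M * B * real ((n1 + n2) * (n1 + n2))"
      using M_nonneg B_nonneg by (intro mult_left_mono of_nat_mono) (auto simp: card_off_diag intro: mult_le_mono2)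
    finally show ?thesis by (simp add: power2_eq_square)
  qed
  then have mG: "measure PM {x \<in> space PM. G x \<ge> \<gamma>} \<le> M * B * (real (n1 + n2))\<^sup>2 / \<gamma>"
    using integral_Markov_inequality_measure[OF intG, of "{}" \<gamma>] pos G0
    by (fastforce intro: order_trans divide_right_mono)
  have "{x \<in> space PM. U x \<le> c * sqrt (G x)} \<subseteq> {x \<in> space PM. (D x)\<^sup>2 \<ge> t1\<^sup>2}
     \<union> {x \<in> space PM. (Lin x)\<^sup>2 \<ge> t2\<^sup>2} \<union> {x \<in> space PM. G x \<ge> \<gamma>}"
  proof (rule subsetI, rule ccontr)
    fix x assume x: "x \<in> {x \<in> space PM. U x \<le> c * sqrt (G x)}"
      and nx: "x \<notin> {x \<in> space PM. (D x)\<^sup>2 \<ge> t1\<^sup>2} \<union> {x \<in> space PM. (Lin x)\<^sup>2 \<ge> t2\<^sup>2} \<union> {x \<in> space PM. G x \<ge> \<gamma>}"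
    then have "(D x)\<^sup>2 < t1\<^sup>2" "(Lin x)\<^sup>2 < t2\<^sup>2" "G x < \<gamma>" by auto
    then have "\<bar>D x\<bar> < t1" "\<bar>Lin x\<bar> < t2" "sqrt (G x) \<le> sqrt \<gamma>"
      using pos power2_less_imp_less[of "\<bar>D x\<bar>" t1] power2_less_imp_less[of "\<bar>Lin x\<bar>" t2] by simp_all
    moreover from this have "c * sqrt (G x) \<le> c * sqrt \<gamma>" using pos by (intro mult_left_mono) auto
    ultimately have "U x > c * sqrt (G x)" using \<theta> unfolding U_decomposition by linarith
    with x show False by simp
  qed
  then have "measure PM E \<le> measure PM ({x \<in> space PM. (D x)\<^sup>2 \<ge> t1\<^sup>2}
     \<union> {x \<in> space PM. (Lin x)\<^sup>2 \<ge> t2\<^sup>2} \<union> {x \<in> space PM. G x \<ge> \<gamma>})"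
    by (intro P.finite_measure_mono order_trans[OF E[folded G_def]]) measurable
  also have "\<dots> \<le> measure PM ({x \<in> space PM. (D x)\<^sup>2 \<ge> t1\<^sup>2} \<union> {x \<in> space PM. (Lin x)\<^sup>2 \<ge> t2\<^sup>2})
     + measure PM {x \<in> space PM. G x \<ge> \<gamma>}"
    by (rule measure_Un_le) measurable
  also have "measure PM ({x \<in> space PM. (D x)\<^sup>2 \<ge> t1\<^sup>2} \<union> {x \<in> space PM. (Lin x)\<^sup>2 \<ge> t2\<^sup>2})
     \<le> measure PM {x \<in> space PM. (D x)\<^sup>2 \<ge> t1\<^sup>2} + measure PM {x \<in> space PM. (Lin x)\<^sup>2 \<ge> t2\<^sup>2}"
    by (rule measure_Un_le) measurable
  finally show ?thesis using mD mL mG unfolding G_def by linarith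
qed

end

section \<open>Gaussian kernel and bounded densities\<close>

lemma Basis_vec_real: "(Basis :: (real^'d) set) = range (\<lambda>i. axis i 1)"
  by (auto simp: Basis_vec_def)

lemma prod_Basis_vec:
  fixes f :: "real^'d \<Rightarrow> 'b :: comm_monoid_mult"
  shows "(\<Prod>b\<in>Basis. f b) = (\<Prod>i\<in>UNIV. f (axis i 1))"
  unfolding Basis_vec_real by (subst prod.reindex) (auto simp: inj_on_def axis_eq_axis)

lemma gauss_kernel_eq_prod:
  fixes bw :: "real^'d"
  assumes bw: "\<forall>i. bw $ i > 0"
  shows "gauss_kernel bw x = (\<Prod>b\<in>Basis. normal_density 0 (bw \<bullet> b) (x \<bullet> b))"
proof -
  have "normal_density 0 (bw $ i) (x $ i)
      = 1 / (sqrt (2 * pi) * bw $ i) * exp (- (1/2) * ((x $ i)\<^sup>2 / (bw $ i)\<^sup>2))" for i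
    using bw[rule_format, of i] by (simp add: normal_density_def real_sqrt_mult)
  then have "(\<Prod>b\<in>Basis. normal_density 0 (bw \<bullet> b) (x \<bullet> b))
      = (\<Prod>i\<in>UNIV. 1 / (sqrt (2 * pi) * bw $ i) * exp (- (1/2) * ((x $ i)\<^sup>2 / (bw $ i)\<^sup>2)))"
    by (simp add: prod_Basis_vec inner_axis)
  also have "\<dots> = 1 / (sqrt (2 * pi) ^ CARD('d) * (\<Prod>i\<in>UNIV. bw $ i))
      * exp (- (1/2) * (\<Sum>i\<in>UNIV. (x $ i)\<^sup>2 / (bw $ i)\<^sup>2))"
    by (simp add: prod.distrib prod_dividef exp_sum sum_distrib_left)
  also have "sqrt (2 * pi) ^ CARD('d) = (2 * pi) powr (real CARD('d) / 2)"
    by (simp add: powr_half_sqrt[symmetric] powr_powr flip: powr_realpow)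
  finally show ?thesis by (simp add: gauss_kernel_def)
qed

text \<open>The factor (2 pi)^(d/2), being at least 1, is dropped, which keeps the final constant
  free of the dimension.\<close>

lemma gauss_kernel_bounds:
  fixes bw :: "real^'d"
  assumes bw: "\<forall>i. bw $ i > 0"
  shows "0 \<le> gauss_kernel bw x" "gauss_kernel bw x \<le> 1 / (\<Prod>i\<in>UNIV. bw $ i)"
proof -
  let ?L = "\<Prod>i\<in>UNIV. bw $ i"
  have L: "?L > 0" using bw by (intro prod_pos) auto
  have e: "exp (- (1/2) * (\<Sum>i\<in>UNIV. (x $ i)\<^sup>2 / (bw $ i)\<^sup>2)) \<le> 1"
    by (simp add: sum_nonneg)
  have p: "1 \<le> (2 * pi) powr (real CARD('d) / 2)"
    using pi_gt3 by (intro ge_one_powr_ge_zero) auto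
  show "0 \<le> gauss_kernel bw x" using L unfolding gauss_kernel_def by simp
  have "gauss_kernel bw x \<le> 1 / ((2 * pi) powr (real CARD('d) / 2) * ?L) * 1"
    unfolding gauss_kernel_def using L by (intro mult_left_mono e) simp
  also have "\<dots> \<le> 1 / ?L"
    using L p by (simp add: divide_simps)
  finally show "gauss_kernel bw x \<le> 1 / ?L" .
qed

lemma gauss_kernel_sym: "gauss_kernel bw (x - y) = gauss_kernel bw (y - x)"
  unfolding gauss_kernel_def by (simp add: power2_commute)

lemma has_bochner_integral_gauss_kernel:
  fixes bw :: "real^'d"
  assumes bw: "\<forall>i. bw $ i > 0"
  shows "has_bochner_integral lborel (\<lambda>t. gauss_kernel bw (t - y)) 1"
proof -
  have b: "bw \<bullet> b > 0" if "b \<in> Basis" for b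
    using that bw by (auto simp: Basis_vec_real inner_axis)
  have "(\<integral>\<^sup>+t. ennreal (gauss_kernel bw (t - y)) \<partial>lborel) = (\<integral>\<^sup>+t. ennreal (gauss_kernel bw (t - y)) \<partial>distr lborel borel ((+) y))"
    by (simp add: lborel_distr_plus)
  also have "\<dots> = (\<integral>\<^sup>+t. ennreal (gauss_kernel bw t) \<partial>lborel)"
    by (subst nn_integral_distr) auto
  also have "\<dots> = (\<integral>\<^sup>+t. (\<Prod>b\<in>Basis. ennreal (normal_density 0 (bw \<bullet> b) (t \<bullet> b))) \<partial>lborel)"
    unfolding gauss_kernel_eq_prod[OF bw] by (simp add: prod_ennreal)
  also have "\<dots> = (\<Prod>b\<in>Basis. \<integral>\<^sup>+t. ennreal (normal_density 0 (bw \<bullet> b) t) \<partial>lborel)"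
    by (rule nn_integral_lborel_prod) auto
  also have "\<dots> = (\<Prod>b\<in>(Basis :: (real^'d) set). 1)"
    by (intro prod.cong refl, subst nn_integral_eq_integral) (auto simp: b)
  finally show ?thesis
    using gauss_kernel_bounds[OF bw] by (intro has_bochner_integral_nn_integral) auto
qed

section \<open>Bounded densities and their smoothing\<close>

lemma pdf_nonneg: "0 \<le> pdf P x"
  by (simp add: pdf_def)

lemma pdf_measurable [measurable]: "pdf P \<in> borel_measurable borel"
proof -
  have "(\<lambda>x. enn2real (RN_deriv lborel P x)) \<in> borel_measurable lborel" by measurable
  then show ?thesis unfolding pdf_def[abs_def] by simp
qed

text \<open>The Radon-Nikodym derivative agrees almost everywhere with the given density, which is
  almost everywhere finite as its total mass is one. Passing to real values in \<open>pdf\<close>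
  therefore loses nothing.\<close>

lemma density_pdf:
  assumes "prob_space P" "has_lebesgue_pdf P"
  shows "P = density lborel (\<lambda>x. ennreal (pdf P x))"
proof -
  obtain f where f [measurable]: "f \<in> borel_measurable lborel" and P: "P = density lborel f"
    using assms(2) unfolding has_lebesgue_pdf_def by blast
  interpret prob_space P by (rule assms(1))
  have "AE x in lborel. f x = RN_deriv lborel P x"
    by (rule sigma_finite_measure.RN_deriv_unique[OF sigma_finite_lborel f P[symmetric]])
  moreover have "AE x in lborel. f x \<noteq> \<infinity>"
  proof (rule nn_integral_PInf_AE[OF f])
    have "(\<integral>\<^sup>+x. f x \<partial>lborel) = emeasure P (space P)"
      unfolding P by (simp add: emeasure_density)
    then show "(\<integral>\<^sup>+x. f x \<partial>lborel) \<noteq> \<infinity>" by (simp add: emeasure_space_1)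
  qed
  ultimately have "AE x in lborel. f x = ennreal (pdf P x)"
    by eventually_elim (simp add: pdf_def less_top)
  then have "density lborel f = density lborel (\<lambda>x. ennreal (pdf P x))"
    by (intro density_cong) auto
  then show ?thesis using P by simp
qed

lemma Linf_norm_le_imp_AE: "Linf_norm f \<le> ereal M \<Longrightarrow> AE x in lborel. \<bar>f x\<bar> \<le> M"
proof -
  assume "Linf_norm f \<le> ereal M"
  moreover have "AE x in lborel. ereal \<bar>f x\<bar> \<le> Linf_norm f"
    unfolding Linf_norm_def by (rule esssup_AE)
  ultimately show ?thesis by (auto elim!: eventually_mono dest: order_trans)
qed

locale bounded_density = prob_space P for P :: "(real^'d) measure" +
  fixes M :: real
  assumes has_pdf: "has_lebesgue_pdf P" and Linf: "Linf_norm (pdf P) \<le> ereal M"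
begin

lemma P_eq: "P = density lborel (\<lambda>x. ennreal (pdf P x))"
  by (rule density_pdf) (use prob_space_axioms has_pdf in auto)

lemma sets_P [measurable_cong, simp]: "sets P = sets borel"
  by (subst P_eq) simp

lemma pdf_le: "AE x in lborel. pdf P x \<le> M"
  using Linf_norm_le_imp_AE[OF Linf] by eventually_elim simp

lemma integral_P:
  assumes [measurable]: "h \<in> borel_measurable borel"
  shows "(\<integral>x. h x \<partial>P) = (\<integral>x. pdf P x * h x \<partial>lborel)"
  by (subst P_eq, subst integral_density) (auto simp: pdf_nonneg)

lemma integrable_pdf_mult_iff:
  assumes [measurable]: "h \<in> borel_measurable borel"
  shows "integrable lborel (\<lambda>x. pdf P x * h x) \<longleftrightarrow> integrable P h"
proof -
  have "integrable (density lborel (\<lambda>x. ennreal (pdf P x))) h \<longleftrightarrow> integrable lborel (\<lambda>x. pdf P x * h x)"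
    by (subst integrable_density) (auto simp: pdf_nonneg)
  then show ?thesis unfolding P_eq[symmetric] by blast
qed

lemma integral_P_le:
  assumes "integrable lborel h" "\<And>x. 0 \<le> h x"
  shows "(\<integral>x. h x \<partial>P) \<le> M * (\<integral>x. h x \<partial>lborel)"
proof -
  have [measurable]: "h \<in> borel_measurable borel" using assms(1) by auto
  have "(\<integral>x. pdf P x * h x \<partial>lborel) \<le> (\<integral>x. M * h x \<partial>lborel)"
  proof (rule integral_mono_AE')
    show "AE x in lborel. pdf P x * h x \<le> M * h x"
      using pdf_le by eventually_elim (simp add: assms(2) mult_right_mono)
    show "AE x in lborel. 0 \<le> M * h x"
      using pdf_le by eventually_elim (use assms(2) pdf_nonneg order_trans in \<open>blast intro: mult_nonneg_nonneg\<close>)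
  qed (use assms in auto)
  then show ?thesis by (simp add: integral_P)
qed

lemma integrable_pdf: "integrable lborel (pdf P)"
  using integrable_pdf_mult_iff[of "\<lambda>_. 1"] by simp

lemma gauss_kernel_mean_le:
  assumes bw: "\<forall>i. bw $ i > 0"
  shows "(\<integral>y. gauss_kernel bw (x - y) \<partial>P) \<le> M"
  using integral_P_le[of "\<lambda>y. gauss_kernel bw (y - x)"] has_bochner_integral_gauss_kernel[OF bw, of x]
    gauss_kernel_bounds[OF bw] gauss_kernel_sym[of bw x]
  by (simp add: has_bochner_integral_iff)

lemma integrable_smoothed:
  assumes bw: "\<forall>i. bw $ i > 0"
  shows "integrable lborel (\<lambda>t. \<integral>y. gauss_kernel bw (t - y) \<partial>P)"
proof -
  interpret pair_sigma_finite P lborel ..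
  have "integrable (P \<Otimes>\<^sub>M lborel) (\<lambda>(y, t). gauss_kernel bw (t - y))"
    using has_bochner_integral_gauss_kernel[OF bw] gauss_kernel_bounds(1)[OF bw]
    by (intro Fubini_integrable) (auto simp: has_bochner_integral_iff)
  then show ?thesis by (rule integrable_snd)
qed

end

section \<open>The alternative: signal, fluctuations and the choice of thresholds\<close>

lemma L2_norm_power2: "(L2_norm f)\<^sup>2 = (\<integral>x. (f x)\<^sup>2 \<partial>lborel)"
  by (simp add: L2_norm_def)

locale density_pair =
  Y: bounded_density PY M + Z: bounded_density PZ M for PY PZ :: "(real^'d) measure" and M :: real +
  fixes bw :: "real^'d" and n1 n2 :: nat
  assumes bw: "\<forall>i. bw $ i > 0" and n1: "2 \<le> n1" and n2: "2 \<le> n2"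
begin

definition L :: real where "L = (\<Prod>i\<in>UNIV. bw $ i)"

lemma L_pos: "L > 0" unfolding L_def using bw by (intro prod_pos) auto

sublocale T: two_sample PY PZ n1 n2 "\<lambda>x y. gauss_kernel bw (x - y)" "1 / L" M
proof (intro two_sample.intro kernel_sample.intro two_sample_axioms.intro)
  show "(\<lambda>(x, y). gauss_kernel bw (x - y)) \<in> borel_measurable (borel \<Otimes>\<^sub>M borel)" by measurable
  show "gauss_kernel bw (x - y) = gauss_kernel bw (y - x)" for x y by (rule gauss_kernel_sym)
  show "0 \<le> gauss_kernel bw (x - y)" "gauss_kernel bw (x - y) \<le> 1 / L" for x y
    unfolding L_def by (rule gauss_kernel_bounds[OF bw])+
  show "(\<integral>y. gauss_kernel bw (x - y) \<partial>(if a \<le> n1 then PY else PZ)) \<le> M" for a x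
    using Y.gauss_kernel_mean_le[OF bw] Z.gauss_kernel_mean_le[OF bw] by simp
  show "prob_space (if a \<le> n1 then PY else PZ)" for a
    using Y.prob_space_axioms Z.prob_space_axioms by simp
qed (simp_all add: n1 n2)

definition \<delta> :: "real^'d \<Rightarrow> real" where "\<delta> x = pdf PY x - pdf PZ x"

lemma \<delta>_measurable [measurable]: "\<delta> \<in> borel_measurable borel"
  unfolding \<delta>_def[abs_def] by measurable

lemma integrable_pdf_bounded:
  assumes [measurable]: "h \<in> borel_measurable borel" and "\<And>x. \<bar>h x\<bar> \<le> C"
  shows "integrable lborel (\<lambda>x. pdf PY x * h x)" "integrable lborel (\<lambda>x. pdf PZ x * h x)"
  unfolding Y.integrable_pdf_mult_iff[OF assms(1)] Z.integrable_pdf_mult_iff[OF assms(1)]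
  using assms(2) by (auto intro!: Y.integrable_const_bound[of _ C] Z.integrable_const_bound[of _ C])

lemma convolve_\<delta>: "convolve \<delta> (gauss_kernel bw) x = T.\<psi> x"
proof -
  have "\<bar>gauss_kernel bw (x - y)\<bar> \<le> 1 / L" for y
    using T.g_nonneg[of x y] T.g_le[of x y] by simp
  then show ?thesis
    unfolding convolve_def T.\<psi>_def \<delta>_def left_diff_distrib
    by (subst Bochner_Integration.integral_diff) (auto intro!: integrable_pdf_bounded simp: Y.integral_P Z.integral_P)
qed

lemma integrable_\<psi>: "integrable lborel T.\<psi>"
  unfolding T.\<psi>_def[abs_def]
  using Y.integrable_smoothed[OF bw] Z.integrable_smoothed[OF bw] by simp

lemma integrable_\<psi>2: "integrable lborel (\<lambda>x. (T.\<psi> x)\<^sup>2)"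
proof (rule Bochner_Integration.integrable_bound[of _ "\<lambda>x. 1 / L * T.\<psi> x"])
  have "\<bar>T.\<psi> x\<bar> * \<bar>T.\<psi> x\<bar> \<le> 1 / L * \<bar>T.\<psi> x\<bar>" for x
    using T.\<psi>_bound by (intro mult_right_mono) auto
  then show "AE x in lborel. norm ((T.\<psi> x)\<^sup>2) \<le> norm (1 / L * T.\<psi> x)"
    using L_pos by (intro AE_I2) (simp add: power2_eq_square abs_mult)
qed (use integrable_\<psi> in auto)

lemma integrable_\<delta>\<psi>: "integrable lborel (\<lambda>x. \<delta> x * T.\<psi> x)"
  unfolding \<delta>_def left_diff_distrib
  by (intro Bochner_Integration.integrable_diff integrable_pdf_bounded[of _ "1 / L"] T.\<psi>_bound) auto

lemma integrable_\<delta>2: "integrable lborel (\<lambda>x. (\<delta> x)\<^sup>2)"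
proof (rule Bochner_Integration.integrable_bound[of _ "\<lambda>x. M * \<delta> x"])
  show "AE x in lborel. norm ((\<delta> x)\<^sup>2) \<le> norm (M * \<delta> x)"
    using Y.pdf_le Z.pdf_le
  proof eventually_elim
    case (elim x)
    then have "\<bar>\<delta> x\<bar> \<le> M" using pdf_nonneg[of PY x] pdf_nonneg[of PZ x] by (simp add: \<delta>_def)
    then have "\<bar>\<delta> x\<bar> * \<bar>\<delta> x\<bar> \<le> \<bar>M\<bar> * \<bar>\<delta> x\<bar>" by (intro mult_right_mono) auto
    then show ?case by (simp add: power2_eq_square abs_mult)
  qed
qed (use Y.integrable_pdf Z.integrable_pdf in \<open>auto simp: \<delta>_def[abs_def]\<close>)

lemma \<theta>_eq: "T.\<theta> = (\<integral>x. \<delta> x * T.\<psi> x \<partial>lborel)"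
  unfolding T.\<theta>_def Y.integral_P[OF T.\<psi>_measurable] Z.integral_P[OF T.\<psi>_measurable] \<delta>_def left_diff_distrib
  by (rule Bochner_Integration.integral_diff[symmetric]) (intro integrable_pdf_bounded[of _ "1 / L"] T.\<psi>_bound T.\<psi>_measurable)+

text \<open>The subtracted norm is exactly the bias term of the separation condition, so under that
  condition \<open>2 * T.\<theta>\<close> is at least the squared norm of \<open>T.\<psi>\<close>
  plus the term with the constant.\<close>

lemma \<theta>_polarization:
  "2 * T.\<theta> = (L2_norm \<delta>)\<^sup>2 + (\<integral>x. (T.\<psi> x)\<^sup>2 \<partial>lborel)
     - (L2_norm (\<lambda>x. \<delta> x - convolve \<delta> (gauss_kernel bw) x))\<^sup>2"
proof -
  have "(\<integral>x. (\<delta> x - T.\<psi> x)\<^sup>2 \<partial>lborel) = (\<integral>x. (\<delta> x)\<^sup>2 + (T.\<psi> x)\<^sup>2 - 2 * (\<delta> x * T.\<psi> x) \<partial>lborel)"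
    by (simp add: power2_diff mult.assoc)
  also have "\<dots> = (\<integral>x. (\<delta> x)\<^sup>2 \<partial>lborel) + (\<integral>x. (T.\<psi> x)\<^sup>2 \<partial>lborel) - 2 * T.\<theta>"
    using integrable_\<delta>2 integrable_\<psi>2 integrable_\<delta>\<psi> by (simp add: \<theta>_eq)
  finally show ?thesis unfolding L2_norm_power2 convolve_\<delta> by linarith
qed

text \<open>The variance of the linear part is thereby controlled by the same squared norm that the
  polarization identity adds to the signal.\<close>

lemma \<psi>_second_moment_le:
  "(\<integral>x. (T.\<psi> x)\<^sup>2 \<partial>PY) \<le> M * (\<integral>x. (T.\<psi> x)\<^sup>2 \<partial>lborel)"
  "(\<integral>x. (T.\<psi> x)\<^sup>2 \<partial>PZ) \<le> M * (\<integral>x. (T.\<psi> x)\<^sup>2 \<partial>lborel)"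
  using integrable_\<psi>2 by (auto intro!: Y.integral_P_le Z.integral_P_le)

text \<open>The three summands of the constant pay for \<open>t2\<close>, \<open>t1\<close> and the
  acceptance bound: apart from the \<open>s / 2\<close> in \<open>t2\<close>, these are at most
  \<open>6 * M\<close>, \<open>24 * sqrt M\<close> and \<open>80 * \<kappa> * sqrt M\<close> times
  the common scale \<open>X\<close>, and polarization doubles each.\<close>

lemma type_II_error_le:
  assumes \<alpha>: "0 < \<alpha>" "\<alpha> < exp (-1)" and \<beta>: "0 < \<beta>" "\<beta> < 1" and M: "M > 0" and L1: "L \<le> 1"
    and \<kappa>: "real (n1 + n2) \<le> \<kappa> * real (min n1 n2)"
    and sep: "(L2_norm \<delta>)\<^sup>2 \<ge> (L2_norm (\<lambda>x. \<delta> x - convolve \<delta> (gauss_kernel bw) x))\<^sup>2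
      + (12 * M + 48 * sqrt M + 160 * \<kappa> * sqrt M) / (\<beta> * sqrt L) * ln (1 / \<alpha>) * (1 / real n1 + 1 / real n2)"
  shows "measure (sample_law n1 n2 (PY, PZ)) {x \<in> space (sample_law n1 n2 (PY, PZ)). \<not> reject bw n1 n2 \<alpha> x} \<le> \<beta>"
proof -
  define m where "m = min n1 n2"
  define N where "N = real (n1 + n2)"
  define s where "s = (\<integral>x. (T.\<psi> x)\<^sup>2 \<partial>lborel)"
  define A where "A = ln (1 / \<alpha>)"
  define q where "q = sqrt L"
  define X where "X = A * T.r / (\<beta> * q)"
  \<comment> \<open>The thresholds \<open>t1\<close>, \<open>t2\<close>, \<open>\<gamma>\<close> are chosen so that each of the three tails costs \<open>\<beta> / 3\<close>.\<close>
  define t1 where "t1 = 24 * sqrt M / (q * sqrt \<beta>) * T.r"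
  define t2 where "t2 = s / 2 + 6 * T.r * M / \<beta>"
  define \<gamma> where "\<gamma> = 3 * M * N\<^sup>2 / (L * \<beta>)"
  define c where "c = 20 * A / (real m * (real m - 1))"
  have m: "2 \<le> m" "m \<le> n1" "m \<le> n2" using n1 n2 by (auto simp: m_def)
  have q: "0 < q" "q \<le> 1" "q\<^sup>2 = L" using L_pos L1 by (auto simp: q_def)
  have N: "N > 0" using n1 by (simp add: N_def)
  have r: "T.r > 0" by (rule T.r_pos)
  have s: "s \<ge> 0" unfolding s_def by simp
  have "ln \<alpha> < ln (exp (-1))" using \<alpha> by (subst ln_less_cancel_iff) auto
  then have A: "A > 1" using \<alpha> by (simp add: A_def ln_div)
  have sM: "sqrt M > 0" "sqrt M * sqrt M = M" using M by auto
  have s\<beta>: "sqrt \<beta> > 0" "sqrt \<beta> * sqrt \<beta> = \<beta>" "\<beta> \<le> sqrt \<beta>"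
    using \<beta> real_sqrt_le_1_iff[of \<beta>] mult_left_mono[of "sqrt \<beta>" 1 "sqrt \<beta>"] by auto
  have \<kappa>0: "\<kappa> > 0"
  proof (rule ccontr)
    assume "\<not> \<kappa> > 0"
    then have "\<kappa> * real m \<le> 0" by (intro mult_nonpos_nonneg) auto
    then show False using \<kappa> N unfolding m_def N_def by linarith
  qed
  have X1: "T.r / (q * sqrt \<beta>) \<le> X"
  proof -
    have "T.r / (q * sqrt \<beta>) \<le> T.r / (\<beta> * q)"
      using r q \<beta> s\<beta> by (intro divide_left_mono) (auto simp: mult.commute[of q] intro: mult_right_mono)
    also have "\<dots> \<le> X" unfolding X_def using A r q \<beta> by (intro divide_right_mono) auto
    finally show ?thesis .
  qed
  have X2: "T.r / \<beta> \<le> X"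
  proof -
    have "T.r / \<beta> \<le> T.r / (\<beta> * q)"
      using r q \<beta> by (intro divide_left_mono) (auto simp: mult_le_cancel_left1)
    also have "\<dots> \<le> X" unfolding X_def using A r q \<beta> by (intro divide_right_mono) auto
    finally show ?thesis .
  qed
  have t1: "t1 > 0" using sM q s\<beta> r by (simp add: t1_def)
  have t2: "t2 > 0" using s r M \<beta> by (simp add: t2_def add_nonneg_pos)
  have \<gamma>: "\<gamma> > 0" using M N L_pos \<beta> by (simp add: \<gamma>_def)
  have c: "c \<ge> 0" using A m by (simp add: c_def)
  have t1X: "t1 \<le> 24 * sqrt M * X"
    using mult_left_mono[OF X1, of "24 * sqrt M"] sM by (simp add: t1_def)
  have t2X: "t2 \<le> s / 2 + 6 * M * X"
    using mult_left_mono[OF X2, of "6 * M"] M by (simp add: t2_def mult_ac)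
  \<comment> \<open>Comparability of the sample sizes enters here: it turns
    \<open>N / (m * (m - 1))\<close> into a multiple of \<open>T.r\<close>. The 80 is 20 from the
    acceptance bound, 2 from \<open>m / (m - 1) \<le> 2\<close> and 2 from
    \<open>sqrt 3 \<le> 2\<close>.\<close>
  have cX: "c * sqrt \<gamma> \<le> 80 * \<kappa> * sqrt M * X"
  proof -
    have "1 / real m \<le> T.r"
      unfolding T.r_def m_def by (auto simp: min_def)
    then have "N / (real m * (real m - 1)) \<le> 2 * \<kappa> * T.r"
    proof -
      have "N / (real m * (real m - 1)) \<le> \<kappa> * real m / (real m * (real m - 1))"
        using \<kappa> m unfolding m_def N_def by (intro divide_right_mono) auto
      also have "\<dots> \<le> 2 * \<kappa> * (1 / real m)"
        using m \<kappa>0 by (simp add: divide_simps)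
      also have "\<dots> \<le> 2 * \<kappa> * T.r" using \<open>1 / real m \<le> T.r\<close> \<kappa>0 by (intro mult_left_mono) auto
      finally show ?thesis .
    qed
    then have cN: "c * N \<le> 20 * A * (2 * \<kappa> * T.r)"
      using A mult_left_mono[of "N / (real m * (real m - 1))" "2 * \<kappa> * T.r" "20 * A"] by (simp add: c_def)
    have "sqrt \<gamma> = sqrt 3 * sqrt M * N / (q * sqrt \<beta>)"
      using N by (simp add: \<gamma>_def q_def real_sqrt_divide real_sqrt_mult)
    also have "\<dots> \<le> 2 * sqrt M * N / (q * sqrt \<beta>)"
      using sM N q s\<beta> real_le_lsqrt[of 3 2] by (intro divide_right_mono mult_right_mono) (auto simp: real_le_lsqrt)
    finally have "c * sqrt \<gamma> \<le> c * (2 * sqrt M * N / (q * sqrt \<beta>))" using c by (rule mult_left_mono)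
    also have "\<dots> = (c * N) * (2 * sqrt M / (q * sqrt \<beta>))" by simp
    also have "\<dots> \<le> (20 * A * (2 * \<kappa> * T.r)) * (2 * sqrt M / (q * sqrt \<beta>))"
      using cN sM q s\<beta> by (intro mult_right_mono) auto
    also have "\<dots> = 80 * \<kappa> * sqrt M * (A * T.r / (q * sqrt \<beta>))" by simp
    also have "\<dots> \<le> 80 * \<kappa> * sqrt M * X"
    proof (rule mult_left_mono)
      show "A * T.r / (q * sqrt \<beta>) \<le> X" unfolding X_def
        using A r q \<beta> s\<beta> by (intro divide_left_mono) (auto simp: mult.commute[of q] intro: mult_right_mono)
    qed (use \<kappa>0 sM in auto)
    finally show ?thesis .
  qed
  have \<theta>: "T.\<theta> \<ge> t1 + t2 + c * sqrt \<gamma>"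
  proof -
    have "(12 * M + 48 * sqrt M + 160 * \<kappa> * sqrt M) / (\<beta> * sqrt L) * ln (1 / \<alpha>) * (1 / real n1 + 1 / real n2)
       = (12 * M + 48 * sqrt M + 160 * \<kappa> * sqrt M) * X"
      by (simp add: X_def A_def q_def T.r_def)
    then have "2 * T.\<theta> \<ge> s + (12 * M + 48 * sqrt M + 160 * \<kappa> * sqrt M) * X"
      using \<theta>_polarization sep unfolding s_def[symmetric] by linarith
    moreover have "(12 * M + 48 * sqrt M + 160 * \<kappa> * sqrt M) * X
      = 2 * (6 * M * X) + 2 * (24 * sqrt M * X) + 2 * (80 * \<kappa> * sqrt M * X)" by (simp add: distrib_right)
    ultimately show ?thesis using t1X t2X cX by linarith
  qed
  have law: "sample_law n1 n2 (PY, PZ) = T.PM" unfolding sample_law_def fst_conv snd_conv ..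
  let ?E = "{x \<in> space T.PM. \<not> reject bw n1 n2 \<alpha> x}"
  have "?E \<subseteq> {x \<in> space T.PM. T.U x \<le> c * sqrt (\<Sum>(a, b)\<in>off_diag {1..n1+n2}. (gauss_kernel bw (x a - x b))\<^sup>2)}"
    using not_reject_imp_le[OF \<alpha> bw m] unfolding T.U_def c_def A_def U_perm_eq_U_gram by auto
  from T.prob_U_le[OF \<psi>_second_moment_le[folded s_def] t1 t2 \<gamma> c \<theta> this]
  have "measure T.PM ?E \<le> 192 * (M * (1 / L)) * T.r\<^sup>2 / t1\<^sup>2 + 4 * T.r * (M * s) / t2\<^sup>2
      + M * (1 / L) * (real (n1 + n2))\<^sup>2 / \<gamma>" .
  also have "192 * (M * (1 / L)) * T.r\<^sup>2 / t1\<^sup>2 = \<beta> / 3"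
  proof -
    have "t1\<^sup>2 = 576 * M / (L * \<beta>) * T.r\<^sup>2"
      using M \<beta> q by (simp add: t1_def power_mult_distrib power_divide)
    then show ?thesis using M \<beta> L_pos r by (simp only:) (simp add: divide_simps)
  qed
  also have "M * (1 / L) * (real (n1 + n2))\<^sup>2 / \<gamma> = \<beta> / 3"
    unfolding \<gamma>_def N_def[symmetric] using M \<beta> L_pos N by (simp add: field_simps)
  also have "4 * T.r * (M * s) / t2\<^sup>2 \<le> \<beta> / 3"
  proof -
    \<comment> \<open>The two summands of \<open>t2\<close> are matched so that their product, via
      \<open>4 * u * v \<le> (u + v)\<^sup>2\<close>, dominates the variance of the linear part for
      every value of \<open>s\<close>.\<close>
    have "4 * (s / 2) * (6 * T.r * M / \<beta>) \<le> t2\<^sup>2"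
    proof -
      have "4 * u * v \<le> (u + v)\<^sup>2" for u v :: real
        using zero_le_power2[of "u - v"] by (simp add: power2_eq_square algebra_simps)
      then show ?thesis unfolding t2_def .
    qed
    then have "4 * T.r * (M * s) \<le> \<beta> / 3 * t2\<^sup>2" using \<beta> by (simp add: field_simps)
    then show ?thesis using t2 by (simp add: divide_le_eq)
  qed
  finally show ?thesis unfolding law by simp
qed

end

theorem proposition8p4:
  fixes M r1 r2 :: real
  assumes "M > 0" and "r1 > 0" and "r2 > 0"
  shows "\<exists>C>0. \<forall>(\<alpha>::real) (\<beta>::real) (bw :: real^'d) (n1::nat) (n2::nat)
           (eps :: (real^'d) measure \<times> (real^'d) measure \<Rightarrow> real).
         0 < \<alpha> \<and> \<alpha> < exp (-1) \<and> 0 < \<beta> \<and> \<beta> < 1 - \<alpha> \<and>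
         (\<forall>i. bw $ i > 0) \<and> (\<Prod>i\<in>UNIV. bw $ i) \<le> 1 \<and>
         n1 \<ge> 2 \<and> n2 \<ge> 2 \<and> r1 \<le> real n1 / real n2 \<and> real n1 / real n2 \<le> r2 \<and>
         (\<forall>(PY, PZ) \<in> P_infty M. eps (PY, PZ) \<ge> 0 \<and>
            (eps (PY, PZ))\<^sup>2 \<ge>
              (L2_norm (\<lambda>x. (pdf PY x - pdf PZ x)
                 - convolve (\<lambda>y. pdf PY y - pdf PZ y) (gauss_kernel bw) x))\<^sup>2
              + C / (\<beta> * sqrt (\<Prod>i\<in>UNIV. bw $ i)) * ln (1 / \<alpha>) * (1 / real n1 + 1 / real n2))
         \<longrightarrow>
         (SUP P\<in>P_null M. emeasure (sample_law n1 n2 P)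
            {x \<in> space (sample_law n1 n2 P). reject bw n1 n2 \<alpha> x}) \<le> ennreal \<alpha> \<and>
         (SUP P\<in>P_alt M eps. emeasure (sample_law n1 n2 P)
            {x \<in> space (sample_law n1 n2 P). \<not> reject bw n1 n2 \<alpha> x}) \<le> ennreal \<beta>"
proof -
  \<comment> \<open>Chosen to cover both cases of the minimum: n1 + n2 is at most (1 + r2) n2 and at
    most (1 + 1/r1) n1.\<close>
  define \<kappa> where "\<kappa> = 2 + r2 + 1 / r1"
  define C where "C = 12 * M + 48 * sqrt M + 160 * \<kappa> * sqrt M"
  have \<kappa>: "\<kappa> > 0" using assms by (simp add: \<kappa>_def add_pos_pos)
  have C: "C > 0" using assms \<kappa> by (simp add: C_def add_pos_pos)
  show ?thesis
  proof (intro exI[of _ C] conjI C allI impI)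
    fix \<alpha> \<beta> :: real and bw :: "real^'d" and n1 n2 :: nat
      and eps :: "(real^'d) measure \<times> (real^'d) measure \<Rightarrow> real"
    assume H: "0 < \<alpha> \<and> \<alpha> < exp (-1) \<and> 0 < \<beta> \<and> \<beta> < 1 - \<alpha> \<and>
         (\<forall>i. bw $ i > 0) \<and> (\<Prod>i\<in>UNIV. bw $ i) \<le> 1 \<and>
         n1 \<ge> 2 \<and> n2 \<ge> 2 \<and> r1 \<le> real n1 / real n2 \<and> real n1 / real n2 \<le> r2 \<and>
         (\<forall>(PY, PZ) \<in> P_infty M. eps (PY, PZ) \<ge> 0 \<and>
            (eps (PY, PZ))\<^sup>2 \<ge>
              (L2_norm (\<lambda>x. (pdf PY x - pdf PZ x)
                 - convolve (\<lambda>y. pdf PY y - pdf PZ y) (gauss_kernel bw) x))\<^sup>2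
              + C / (\<beta> * sqrt (\<Prod>i\<in>UNIV. bw $ i)) * ln (1 / \<alpha>) * (1 / real n1 + 1 / real n2))"
    then have \<alpha>: "0 < \<alpha>" "\<alpha> < exp (-1)" and \<beta>: "0 < \<beta>" "\<beta> < 1 - \<alpha>" and bw: "\<forall>i. bw $ i > 0"
      and L1: "(\<Prod>i\<in>UNIV. bw $ i) \<le> 1" and n: "2 \<le> n1" "2 \<le> n2"
      and ratio: "r1 \<le> real n1 / real n2" "real n1 / real n2 \<le> r2" by auto
    have "exp (-1) < (1::real)" by simp
    then have \<alpha>1: "\<alpha> < 1" using \<alpha> by linarith
    have \<kappa>m: "real (n1 + n2) \<le> \<kappa> * real (min n1 n2)"
    proof -
      have "real n1 \<le> r2 * real n2" "r1 * real n2 \<le> real n1" using ratio n by (simp_all add: field_simps)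
      then have "real n1 \<le> r2 * real n2" "real n2 \<le> 1 / r1 * real n1" using assms by (simp_all add: field_simps)
      moreover have "0 \<le> r2 * real n1" "0 \<le> 1 / r1 * real n2" using assms by simp_all
      ultimately show ?thesis by (auto simp: \<kappa>_def min_def distrib_right)
    qed
    show "(SUP P\<in>P_null M. emeasure (sample_law n1 n2 P)
            {x \<in> space (sample_law n1 n2 P). reject bw n1 n2 \<alpha> x}) \<le> ennreal \<alpha>"
    proof (rule SUP_least)
      fix P :: "(real^'d) measure \<times> (real^'d) measure" assume "P \<in> P_null M"
      then obtain PY PZ where P: "P = (PY, PZ)" and inf: "(PY, PZ) \<in> P_infty M"
        and eq: "AE x in lborel. pdf PY x = pdf PZ x" by (auto simp: P_null_def)
      from inf interpret Y: prob_space PY by (simp add: P_infty_def)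
      have dens: "PY = density lborel (\<lambda>x. ennreal (pdf PY x))" "PZ = density lborel (\<lambda>x. ennreal (pdf PZ x))"
        using inf by (auto intro!: density_pdf simp: P_infty_def)
      \<comment> \<open>Densities that agree almost everywhere define the same measure, so under the
        null hypothesis the pooled sample is i.i.d.\<close>
      have "density lborel (\<lambda>x. ennreal (pdf PY x)) = density lborel (\<lambda>x. ennreal (pdf PZ x))"
        using eq by (intro density_cong) (auto elim: eventually_mono)
      then have PZ: "PZ = PY" using dens by simp
      have sets: "sets PY = sets borel" by (subst dens(1)) simp
      have law: "sample_law n1 n2 P = Pi\<^sub>M {1..n1+n2} (\<lambda>_. PY)"
        unfolding sample_law_def P PZ fst_conv snd_conv if_cancel ..
      interpret S: prob_space "Pi\<^sub>M {1..n1+n2} (\<lambda>_. PY)" by (intro prob_space_PiM Y.prob_space_axioms)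
      show "emeasure (sample_law n1 n2 P) {x \<in> space (sample_law n1 n2 P). reject bw n1 n2 \<alpha> x} \<le> ennreal \<alpha>"
        unfolding law S.emeasure_eq_measure
        by (intro ennreal_leI permutation_test_level Y.prob_space_axioms sets \<alpha> \<alpha>1)
    qed
    show "(SUP P\<in>P_alt M eps. emeasure (sample_law n1 n2 P)
            {x \<in> space (sample_law n1 n2 P). \<not> reject bw n1 n2 \<alpha> x}) \<le> ennreal \<beta>"
    proof (rule SUP_least)
      fix P assume "P \<in> P_alt M eps"
      then obtain PY PZ where P: "P = (PY, PZ)" and inf: "(PY, PZ) \<in> P_infty M"
        and ge: "eps (PY, PZ) \<le> L2_norm (\<lambda>x. pdf PY x - pdf PZ x)" by (auto simp: P_alt_def)
      interpret density_pair PY PZ M bw n1 n2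
        using inf bw n by (auto simp: density_pair_def bounded_density_def bounded_density_axioms_def
            density_pair_axioms_def P_infty_def)
      from H inf have "0 \<le> eps (PY, PZ)" and
        e: "(eps (PY, PZ))\<^sup>2 \<ge> (L2_norm (\<lambda>x. (pdf PY x - pdf PZ x)
                 - convolve (\<lambda>y. pdf PY y - pdf PZ y) (gauss_kernel bw) x))\<^sup>2
              + C / (\<beta> * sqrt (\<Prod>i\<in>UNIV. bw $ i)) * ln (1 / \<alpha>) * (1 / real n1 + 1 / real n2)"
        by auto
      then have "(eps (PY, PZ))\<^sup>2 \<le> (L2_norm (\<lambda>x. pdf PY x - pdf PZ x))\<^sup>2"
        using ge by (intro power_mono)
      with e have sep: "(L2_norm (\<lambda>x. pdf PY x - pdf PZ x))\<^sup>2 \<ge> (L2_norm (\<lambda>x. (pdf PY x - pdf PZ x)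
                 - convolve (\<lambda>y. pdf PY y - pdf PZ y) (gauss_kernel bw) x))\<^sup>2
              + C / (\<beta> * sqrt (\<Prod>i\<in>UNIV. bw $ i)) * ln (1 / \<alpha>) * (1 / real n1 + 1 / real n2)"
        by linarith
      have err: "measure (sample_law n1 n2 P) {x \<in> space (sample_law n1 n2 P). \<not> reject bw n1 n2 \<alpha> x} \<le> \<beta>"
        unfolding P
      proof (rule type_II_error_le[OF \<alpha> \<beta>(1) _ assms(1) _ \<kappa>m])
        show "\<beta> < 1" using \<beta> \<alpha> by linarith
        show "L \<le> 1" using L1 by (simp add: L_def)
      qed (use sep in \<open>simp only: \<delta>_def[abs_def] L_def C_def\<close>)
      have "prob_space (sample_law n1 n2 P)"
        unfolding P sample_law_def fst_conv snd_conv using Y.prob_space_axioms Z.prob_space_axioms by (intro prob_space_PiM) simp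
      then interpret S: prob_space "sample_law n1 n2 P" .
      show "emeasure (sample_law n1 n2 P)
            {x \<in> space (sample_law n1 n2 P). \<not> reject bw n1 n2 \<alpha> x} \<le> ennreal \<beta>"
        unfolding S.emeasure_eq_measure by (rule ennreal_leI[OF err])
    qed
  qed
qed

end
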